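(* Let $k$ be an algebraically closed field of characteristic $p>0$, let $\mathfrak g$ be a finite dimensional restricted $p$-Lie algebra over $k$, and let $\Gamma$ be the finite group scheme over $k$ such that $\mathcal{O}(\Gamma)=u(\mathfrak g)^*$. Then every associator for $u(\mathfrak g)^*$ is of the form $E(\phi)$ for a unique $\phi\in Z^3(\Gamma,\mathbb{G}_a)$.
   Context: $u(\mathfrak g)$ is the restricted enveloping algebra and $A:=u(\mathfrak g)^*$ its dual, a commutative Hopf algebra that is local with augmentation ideal $I$ satisfying $x^p=0$ for all $x\in I$. An associator for $A$ is an invertible $\Phi\in A^{\otimes3}$ making the Hopf algebra $A$ (with its given comultiplication and counit) a quasi-Hopf algebra; since $A$ is commutative this means $(\mathrm{id}\otimes\mathrm{id}\otimes\Delta)(\Phi)(\Delta\otimes\mathrm{id}\otimes\mathrm{id})(\Phi)=(1\otimes\Phi)(\mathrm{id}\otimes\Delta\otimes\mathrm{id})(\Phi)(\Phi\otimes1)$ and applying the counit to any tensor factor of $\Phi$ gives $1$. $Z^3(\Gamma,\mathbb{G}_a)$ is the group of normalized additive (Hochschild) $3$-cocycles of $\Gamma$ with trivial coefficients, i.e. $\phi\in I^{\otimes3}$ with $(\mathrm{id}\otimes\mathrm{id}\otimes\Delta)(\phi)+(\Delta\otimes\mathrm{id}\otimes\mathrm{id})(\phi)=1\otimes\phi+(\mathrm{id}\otimes\Delta\otimes\mathrm{id})(\phi)+\phi\otimes1$. $E:(I^{\otimes3},+)\to(1+I^{\otimes3},\times)$ is the unique homomorphism of unipotent algebraic groups with $E(T)=\sum_{j=0}^{p-1}T^j/j!$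 for every decomposable $T=a_1\otimes a_2\otimes a_3$, $a_i\in I$. *)

theory Defs
  imports
    "HOL-Library.Poly_Mapping"
    "HOL-Library.Product_Plus"
    "HOL-Library.Function_Algebras"
    "HOL-Library.FuncSet"
    "HOL-Computational_Algebra.Polynomial"
begin

section \<open>Free associative algebras\<close>

datatype 'a word = Word "'a list"

instantiation word :: (type) monoid_add
begin

definition zero_word :: "'a word" where "0 = Word []"

fun plus_word :: "'a word \<Rightarrow> 'a word \<Rightarrow> 'a word" where
  "Word u + Word v = Word (u @ v)"

instance
proof
  fix a b c :: "'a word"
  show "a + b + c = a + (b + c)" by (cases a; cases b; cases c) simp
  show "0 + a = a" by (cases a) (simp add: zero_word_def)
  show "a + 0 = a" by (cases a) (simp add: zero_word_def)
qed

end

text \<open>The monoid algebra of the free monoid: the free associative unital algebra on the set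
  \<^typ>\<open>'g\<close>.  Its tensor square is the monoid algebra of the product monoid.\<close>

type_synonym ('g, 'k) free_algebra = "'g word \<Rightarrow>\<^sub>0 'k"
type_synonym ('g, 'k) free_algebra_sq = "('g word \<times> 'g word) \<Rightarrow>\<^sub>0 'k"

text \<open>Residue classes modulo an ideal, and functions of one to four residue classes.\<close>

type_synonym ('g, 'k) residue_class = "('g, 'k) free_algebra set"
type_synonym ('g, 'k) form1 = "('g, 'k) residue_class \<Rightarrow> 'k"
type_synonym ('g, 'k) form2 =
  "('g, 'k) residue_class \<times> ('g, 'k) residue_class \<Rightarrow> 'k"
type_synonym ('g, 'k) form3 =
  "('g, 'k) residue_class \<times> ('g, 'k) residue_class \<times> ('g, 'k) residue_class \<Rightarrow> 'k"
type_synonym ('g, 'k) form4 =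
  "('g, 'k) residue_class \<times> ('g, 'k) residue_class \<times> ('g, 'k) residue_class \<times>
    ('g, 'k) residue_class \<Rightarrow> 'k"

definition gen :: "'g \<Rightarrow> ('g, 'k::field) free_algebra" where
  "gen x = Poly_Mapping.single (Word [x]) 1"

definition scalar :: "'k::field \<Rightarrow> ('m::monoid_add \<Rightarrow>\<^sub>0 'k)" where
  "scalar c = Poly_Mapping.single 0 c"

text \<open>The algebra homomorphism that sends each generator \<open>x\<close> to \<open>x \<otimes> 1 + 1 \<otimes> x\<close>.\<close>

fun comult_word :: "'g word \<Rightarrow> ('g, 'k::field) free_algebra_sq" where
  "comult_word (Word xs) =
     prod_list (map (\<lambda>x. Poly_Mapping.single (Word [x], 0) 1 + Poly_Mapping.single (0, Word [x]) 1) xs)"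

definition free_comult :: "('g, 'k::field) free_algebra \<Rightarrow> ('g, 'k) free_algebra_sq" where
  "free_comult t = (\<Sum>w\<in>Poly_Mapping.keys t. scalar (Poly_Mapping.lookup t w) * comult_word w)"

inductive_set ideal_gen :: "'r::ring_1 set \<Rightarrow> 'r set" for S where
  base: "s \<in> S \<Longrightarrow> s \<in> ideal_gen S"
| zero: "0 \<in> ideal_gen S"
| add: "s \<in> ideal_gen S \<Longrightarrow> t \<in> ideal_gen S \<Longrightarrow> s + t \<in> ideal_gen S"
| lmult: "s \<in> ideal_gen S \<Longrightarrow> r * s \<in> ideal_gen S"
| rmult: "s \<in> ideal_gen S \<Longrightarrow> s * r \<in> ideal_gen S"


section \<open>Spaces of functions\<close>

definition fscale :: "'k::field \<Rightarrow> ('x \<Rightarrow> 'k) \<Rightarrow> ('x \<Rightarrow> 'k)" where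
  "fscale c f = (\<lambda>x. c * f x)"

definition fspan :: "('x \<Rightarrow> 'k::field) set \<Rightarrow> ('x \<Rightarrow> 'k) set" where
  "fspan = module.span fscale"

lemma vector_space_fscale: "vector_space (fscale :: 'k::field \<Rightarrow> ('x \<Rightarrow> 'k) \<Rightarrow> _)"
  by unfold_locales (auto simp: fscale_def plus_fun_def algebra_simps)

text \<open>Polynomial functions on a space of functions \<open>'x \<Rightarrow> 'k\<close>, the evaluations at points of \<open>'x\<close>
  serving as coordinates.  On a finite-dimensional subspace the evaluations span the linear forms,
  so that the restrictions of these functions are precisely the regular functions of the subspace
  viewed as an affine space.\<close>

inductive_set poly_functions :: "(('x \<Rightarrow> 'k::field) \<Rightarrow> 'k) set" where
  const: "(\<lambda>_. c) \<in> poly_functions"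
| coord: "(\<lambda>f. f x) \<in> poly_functions"
| add: "r \<in> poly_functions \<Longrightarrow> s \<in> poly_functions \<Longrightarrow> (\<lambda>f. r f + s f) \<in> poly_functions"
| mult: "r \<in> poly_functions \<Longrightarrow> s \<in> poly_functions \<Longrightarrow> (\<lambda>f. r f * s f) \<in> poly_functions"

definition regular_map_on :: "('x \<Rightarrow> 'k::field) set \<Rightarrow> (('x \<Rightarrow> 'k) \<Rightarrow> ('y \<Rightarrow> 'k)) \<Rightarrow> bool" where
  "regular_map_on V F \<longleftrightarrow> (\<forall>y. \<exists>r\<in>poly_functions. \<forall>f\<in>V. F f y = r f)"

text \<open>Over a field, the tensor product of spaces of functions on \<open>'x\<close> is realised, as usual, inside
  the functions on the cartesian product: the pure tensor \<open>a \<otimes> b \<otimes> c\<close> is the function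
  \<open>(x, y, z) \<mapsto> a x * b y * c z\<close>, and the tensor product is the span of the pure tensors.\<close>

definition pure2 :: "('x \<Rightarrow> 'k::field) \<Rightarrow> ('x \<Rightarrow> 'k) \<Rightarrow> ('x \<times> 'x \<Rightarrow> 'k)" where
  "pure2 a b = (\<lambda>(x, y). a x * b y)"

definition pure3 :: "('x \<Rightarrow> 'k::field) \<Rightarrow> ('x \<Rightarrow> 'k) \<Rightarrow> ('x \<Rightarrow> 'k) \<Rightarrow> ('x \<times> 'x \<times> 'x \<Rightarrow> 'k)" where
  "pure3 a b c = (\<lambda>(x, y, z). a x * b y * c z)"

definition pure4 :: "('x \<Rightarrow> 'k::field) \<Rightarrow> ('x \<Rightarrow> 'k) \<Rightarrow> ('x \<Rightarrow> 'k) \<Rightarrow> ('x \<Rightarrow> 'k) \<Rightarrow>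
    ('x \<times> 'x \<times> 'x \<times> 'x \<Rightarrow> 'k)" where
  "pure4 a b c d = (\<lambda>(x, y, z, w). a x * b y * c z * d w)"

definition tensor3 :: "('x \<Rightarrow> 'k::field) set \<Rightarrow> ('x \<times> 'x \<times> 'x \<Rightarrow> 'k) set" where
  "tensor3 V = fspan {pure3 a b c |a b c. a \<in> V \<and> b \<in> V \<and> c \<in> V}"


section \<open>Restricted Lie algebras\<close>

text \<open>Multiplication by the indeterminate \<open>\<lambda>\<close> is \<open>pCons 0\<close>; hence \<open>ad_pencil br x y\<close> is the operator
  \<open>ad (\<lambda>x + y)\<close> on polynomials in \<open>\<lambda>\<close> with coefficients in the Lie algebra.\<close>

definition ad_pencil ::
  "('g \<Rightarrow> 'g \<Rightarrow> 'g) \<Rightarrow> 'g \<Rightarrow> 'g \<Rightarrow> 'g::ab_group_add poly \<Rightarrow> 'g poly" where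
  "ad_pencil br x y q = pCons 0 (map_poly (br x) q) + map_poly (br y) q"

text \<open>In \<open>pmap_add\<close> the \<open>i\<close>-th summand is \<open>s\<^sub>i(x, y)\<close>, where \<open>i s\<^sub>i(x, y)\<close> is the coefficient of
  \<open>\<lambda>\<^bsup>i-1\<^esup>\<close> in \<open>ad (\<lambda>x + y)\<^bsup>p-1\<^esup> x\<close>.\<close>

locale restricted_lie_algebra = vector_space scale
  for scale :: "'k::field \<Rightarrow> 'g::ab_group_add \<Rightarrow> 'g" +
  fixes p :: nat
    and br :: "'g \<Rightarrow> 'g \<Rightarrow> 'g"
    and pmap :: "'g \<Rightarrow> 'g"
  assumes char_eq: "CHAR('k) = p"
    and char_pos: "p > 0"
    and br_add_left: "br (x + y) z = br x z + br y z"
    and br_add_right: "br x (y + z) = br x y + br x z"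
    and br_scale_left: "br (scale c x) y = scale c (br x y)"
    and br_scale_right: "br x (scale c y) = scale c (br x y)"
    and br_self: "br x x = 0"
    and jacobi: "br x (br y z) + br y (br z x) + br z (br x y) = 0"
    and pmap_ad: "br (pmap x) y = ((br x) ^^ p) y"
    and pmap_scale: "pmap (scale c x) = scale (c ^ p) (pmap x)"
    and pmap_add: "pmap (x + y) = pmap x + pmap y +
      (\<Sum>i\<in>{1..<p}. scale (inverse (of_nat i)) (coeff ((ad_pencil br x y ^^ (p - 1)) [:x:]) (i - 1)))"
begin

subsection \<open>The restricted enveloping algebra\<close>

definition relators :: "('g, 'k) free_algebra set" where
  "relators =
     {gen (x + y) - (gen x + gen y) |x y. True} \<union>
     {gen (scale c x) - scalar c * gen x |c x. True} \<union>
     {gen (br x y) - (gen x * gen y - gen y * gen x) |x y. True} \<union>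
     {gen (pmap x) - gen x ^ p |x. True}"

definition coset :: "('g, 'k) free_algebra \<Rightarrow> ('g, 'k) residue_class" where
  "coset t = {s. s - t \<in> ideal_gen relators}"

definition uea :: "('g, 'k) residue_class set" where
  "uea = range coset"

definition rep :: "('g, 'k) residue_class \<Rightarrow> ('g, 'k) free_algebra" where
  "rep X = (SOME t. t \<in> X)"

definition uea_mult ::
  "('g, 'k) residue_class \<Rightarrow> ('g, 'k) residue_class \<Rightarrow> ('g, 'k) residue_class" where
  "uea_mult X Y = coset (rep X * rep Y)"

definition uea_one :: "('g, 'k) residue_class" where
  "uea_one = coset 1"

lemma ideal_gen_uminus: "s \<in> ideal_gen S \<Longrightarrow> - s \<in> ideal_gen S"
  using ideal_gen.lmult[of s S "- 1"] by simp

lemma coset_eq_iff: "coset s = coset t \<longleftrightarrow> s - t \<in> ideal_gen relators"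
proof
  assume "coset s = coset t"
  moreover have "s \<in> coset s"
    by (simp add: coset_def ideal_gen.zero)
  ultimately show "s - t \<in> ideal_gen relators"
    by (simp add: coset_def)
next
  assume st: "s - t \<in> ideal_gen relators"
  show "coset s = coset t"
  proof (intro set_eqI iffI)
    fix u assume "u \<in> coset s"
    then show "u \<in> coset t"
      using ideal_gen.add[OF _ st, of "u - s"] by (simp add: coset_def)
  next
    fix u assume "u \<in> coset t"
    then show "u \<in> coset s"
      using ideal_gen.add[OF _ ideal_gen_uminus[OF st], of "u - t"] by (simp add: coset_def)
  qed
qed

lemma rep_coset: "rep (coset t) - t \<in> ideal_gen relators"
proof -
  have "t \<in> coset t"
    by (simp add: coset_def ideal_gen.zero)
  then have "rep (coset t) \<in> coset t"
    unfolding rep_def by (rule someI)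
  then show ?thesis
    by (simp add: coset_def)
qed

lemma uea_mult_coset: "uea_mult (coset s) (coset t) = coset (s * t)"
proof -
  have "(rep (coset s) - s) * rep (coset t) + s * (rep (coset t) - t) \<in> ideal_gen relators"
    by (intro ideal_gen.add ideal_gen.lmult ideal_gen.rmult rep_coset)
  then show ?thesis
    unfolding uea_mult_def coset_eq_iff by (simp add: algebra_simps)
qed

text \<open>The counit kills \<open>\<gg>\<close>; it is induced by the constant coefficient on the free algebra.\<close>

definition uea_counit :: "('g, 'k) form1" where
  "uea_counit X = (if X \<in> uea then Poly_Mapping.lookup (rep X) 0 else 0)"

text \<open>The comultiplication \<open>\<Delta>\<close> of the restricted enveloping algebra is induced by that of the free
  algebra; the ideal generated by the relators being a coideal, the choice of representatives is
  immaterial.  \<open>pair_comult \<beta> X\<close> is the value at \<open>\<Delta> X\<close> of the linear form on the tensor square that is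
  given by a bilinear form \<open>\<beta>\<close>, i.e. the sum of \<open>\<beta> X\<^sub>1 X\<^sub>2\<close> in Sweedler notation.\<close>

definition pair_comult ::
  "(('g, 'k) residue_class \<Rightarrow> ('g, 'k) residue_class \<Rightarrow> 'k) \<Rightarrow> ('g, 'k) residue_class \<Rightarrow> 'k" where
  "pair_comult \<beta> X =
     (if X \<in> uea
      then (\<Sum>(v, w)\<in>Poly_Mapping.keys (free_comult (rep X)).
              Poly_Mapping.lookup (free_comult (rep X)) (v, w) *
              \<beta> (coset (Poly_Mapping.single v 1)) (coset (Poly_Mapping.single w 1)))
      else 0)"


subsection \<open>The dual Hopf algebra\<close>

text \<open>Functions are extended by \<open>0\<close> outside the carrier \<open>uea\<close>.\<close>

definition dual :: "('g, 'k) form1 set" where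
  "dual = {f. (\<forall>s t. f (coset (s + t)) = f (coset s) + f (coset t)) \<and>
              (\<forall>c t. f (coset (scalar c * t)) = c * f (coset t)) \<and>
              (\<forall>X. X \<notin> uea \<longrightarrow> f X = 0)}"

definition dual_mult :: "('g, 'k) form1 \<Rightarrow> ('g, 'k) form1 \<Rightarrow> ('g, 'k) form1" where
  "dual_mult f g = pair_comult (\<lambda>x y. f x * g y)"

abbreviation dual_one :: "('g, 'k) form1" where
  "dual_one \<equiv> uea_counit"

definition dual_comult :: "('g, 'k) form1 \<Rightarrow> ('g, 'k) form2" where
  "dual_comult f = (\<lambda>(x, y). if x \<in> uea \<and> y \<in> uea then f (uea_mult x y) else 0)"

definition dual_counit :: "('g, 'k) form1 \<Rightarrow> 'k" where
  "dual_counit f = f uea_one"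

definition aug_ideal :: "('g, 'k) form1 set" where
  "aug_ideal = {f \<in> dual. dual_counit f = 0}"


subsection \<open>Tensor powers of the dual\<close>

definition one2 :: "('g, 'k) form2" where
  "one2 = pure2 dual_one dual_one"

definition one3 :: "('g, 'k) form3" where
  "one3 = pure3 dual_one dual_one dual_one"

text \<open>The products of the algebras \<open>A \<otimes> A \<otimes> A\<close> and \<open>A \<otimes> A \<otimes> A \<otimes> A\<close>, i.e. \<open>dual_mult\<close> in each
  tensor factor.\<close>

definition mult3 :: "('g, 'k) form3 \<Rightarrow> ('g, 'k) form3 \<Rightarrow> ('g, 'k) form3" where
  "mult3 F G = (\<lambda>(x, y, z).
     pair_comult (\<lambda>x1 x2. pair_comult (\<lambda>y1 y2. pair_comult (\<lambda>z1 z2.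
       F (x1, y1, z1) * G (x2, y2, z2)) z) y) x)"

definition mult4 :: "('g, 'k) form4 \<Rightarrow> ('g, 'k) form4 \<Rightarrow> ('g, 'k) form4" where
  "mult4 F G = (\<lambda>(x, y, z, w).
     pair_comult (\<lambda>x1 x2. pair_comult (\<lambda>y1 y2. pair_comult (\<lambda>z1 z2. pair_comult (\<lambda>w1 w2.
       F (x1, y1, z1, w1) * G (x2, y2, z2, w2)) w) z) y) x)"

definition power3 :: "('g, 'k) form3 \<Rightarrow> nat \<Rightarrow> ('g, 'k) form3" where
  "power3 F j = (mult3 F ^^ j) one3"

text \<open>\<open>comult1\<close>, \<open>comult2\<close>, \<open>comult3\<close> apply the comultiplication, and \<open>counit1\<close>, \<open>counit2\<close>,
  \<open>counit3\<close> the counit, in the first, second, third tensor factor; \<open>tensor_one_left F\<close> and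
  \<open>tensor_one_right F\<close> are \<open>1 \<otimes> F\<close> and \<open>F \<otimes> 1\<close>.\<close>

definition comult1 :: "('g, 'k) form3 \<Rightarrow> ('g, 'k) form4" where
  "comult1 F = (\<lambda>(x, y, z, w). dual_comult (\<lambda>t. F (t, z, w)) (x, y))"

definition comult2 :: "('g, 'k) form3 \<Rightarrow> ('g, 'k) form4" where
  "comult2 F = (\<lambda>(x, y, z, w). dual_comult (\<lambda>t. F (x, t, w)) (y, z))"

definition comult3 :: "('g, 'k) form3 \<Rightarrow> ('g, 'k) form4" where
  "comult3 F = (\<lambda>(x, y, z, w). dual_comult (\<lambda>t. F (x, y, t)) (z, w))"

definition counit1 :: "('g, 'k) form3 \<Rightarrow> ('g, 'k) form2" where
  "counit1 F = (\<lambda>(y, z). dual_counit (\<lambda>t. F (t, y, z)))"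

definition counit2 :: "('g, 'k) form3 \<Rightarrow> ('g, 'k) form2" where
  "counit2 F = (\<lambda>(x, z). dual_counit (\<lambda>t. F (x, t, z)))"

definition counit3 :: "('g, 'k) form3 \<Rightarrow> ('g, 'k) form2" where
  "counit3 F = (\<lambda>(x, y). dual_counit (\<lambda>t. F (x, y, t)))"

definition tensor_one_left :: "('g, 'k) form3 \<Rightarrow> ('g, 'k) form4" where
  "tensor_one_left F = (\<lambda>(x, y, z, w). dual_one x * F (y, z, w))"

definition tensor_one_right :: "('g, 'k) form3 \<Rightarrow> ('g, 'k) form4" where
  "tensor_one_right F = (\<lambda>(x, y, z, w). F (x, y, z) * dual_one w)"

lemma pair_comult_scale_right: "pair_comult (\<lambda>x y. c * \<beta> x y) X = c * pair_comult \<beta> X"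
  by (simp add: pair_comult_def sum_distrib_left case_prod_beta mult_ac)

lemma mult3_pure:
  "mult3 (pure3 a b c) (pure3 a' b' c') = pure3 (dual_mult a a') (dual_mult b b') (dual_mult c c')"
proof
  fix X
  have h1: "pair_comult (\<lambda>z1 z2. a x1 * b y1 * c z1 * (a' x2 * b' y2 * c' z2)) z =
        (a x1 * a' x2) * ((b y1 * b' y2) * dual_mult c c' z)" for x1 y1 x2 y2 z
  proof -
    have "pair_comult (\<lambda>z1 z2. a x1 * b y1 * c z1 * (a' x2 * b' y2 * c' z2)) z =
          pair_comult (\<lambda>z1 z2. (a x1 * a' x2 * (b y1 * b' y2)) * (c z1 * c' z2)) z"
      by (rule arg_cong[where f = "\<lambda>\<beta>. pair_comult \<beta> z"]) (auto intro!: ext simp: mult_ac)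
    then show ?thesis
      by (simp only: pair_comult_scale_right) (simp add: dual_mult_def mult_ac)
  qed
  have h2: "pair_comult (\<lambda>y1 y2. a x1 * a' x2 * (b y1 * b' y2 * r)) y =
        (a x1 * a' x2) * (dual_mult b b' y * r)" for x1 x2 y r
  proof -
    have "pair_comult (\<lambda>y1 y2. a x1 * a' x2 * (b y1 * b' y2 * r)) y =
          pair_comult (\<lambda>y1 y2. (a x1 * a' x2 * r) * (b y1 * b' y2)) y"
      by (rule arg_cong[where f = "\<lambda>\<beta>. pair_comult \<beta> y"]) (auto intro!: ext simp: mult_ac)
    then show ?thesis
      by (simp only: pair_comult_scale_right) (simp add: dual_mult_def mult_ac)
  qed
  have h3: "pair_comult (\<lambda>x1 x2. a x1 * a' x2 * r) x = dual_mult a a' x * r" for x r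
  proof -
    have "pair_comult (\<lambda>x1 x2. a x1 * a' x2 * r) x = pair_comult (\<lambda>x1 x2. r * (a x1 * a' x2)) x"
      by (rule arg_cong[where f = "\<lambda>\<beta>. pair_comult \<beta> x"]) (auto intro!: ext simp: mult_ac)
    then show ?thesis
      by (simp only: pair_comult_scale_right) (simp add: dual_mult_def mult_ac)
  qed
  show "mult3 (pure3 a b c) (pure3 a' b' c') X =
      pure3 (dual_mult a a') (dual_mult b b') (dual_mult c c') X"
    by (cases X) (simp add: mult3_def pure3_def h1 h2 h3; simp add: mult.assoc)
qed

lemma comult_pure:
  "comult1 (pure3 a b c) (x, y, z, w) = dual_comult a (x, y) * b z * c w"
  "comult2 (pure3 a b c) (x, y, z, w) = a x * dual_comult b (y, z) * c w"
  "comult3 (pure3 a b c) (x, y, z, w) = a x * b y * dual_comult c (z, w)"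
  by (simp_all add: comult1_def comult2_def comult3_def dual_comult_def pure3_def)

lemma counit_pure:
  "counit1 (pure3 a b c) = fscale (dual_counit a) (pure2 b c)"
  "counit2 (pure3 a b c) = fscale (dual_counit b) (pure2 a c)"
  "counit3 (pure3 a b c) = fscale (dual_counit c) (pure2 a b)"
  by (auto simp: counit1_def counit2_def counit3_def dual_counit_def pure3_def pure2_def fscale_def)

lemma tensor_one_pure:
  "tensor_one_left (pure3 a b c) = pure4 dual_one a b c"
  "tensor_one_right (pure3 a b c) = pure4 a b c dual_one"
  by (auto simp: tensor_one_left_def tensor_one_right_def pure3_def pure4_def)


subsection \<open>Associators, additive cocycles and the exponential homomorphism\<close>

definition associator :: "('g, 'k) form3 \<Rightarrow> bool" where
  "associator \<Phi> \<longleftrightarrow>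
     \<Phi> \<in> tensor3 dual \<and>
     (\<exists>\<Psi>\<in>tensor3 dual. mult3 \<Phi> \<Psi> = one3 \<and> mult3 \<Psi> \<Phi> = one3) \<and>
     mult4 (comult3 \<Phi>) (comult1 \<Phi>) =
       mult4 (mult4 (tensor_one_left \<Phi>) (comult2 \<Phi>)) (tensor_one_right \<Phi>) \<and>
     counit1 \<Phi> = one2 \<and> counit2 \<Phi> = one2 \<and> counit3 \<Phi> = one2"

text \<open>The normalized additive cocycles \<open>Z\<^sup>3(\<Gamma>, \<G>\<^sub>a)\<close> of the group scheme \<open>\<Gamma>\<close> with coordinate
  Hopf algebra \<open>dual\<close>.\<close>

definition cocycles3 :: "('g, 'k) form3 set" where
  "cocycles3 = {\<phi> \<in> tensor3 aug_ideal.
     comult3 \<phi> + comult1 \<phi> = tensor_one_left \<phi> + comult2 \<phi> + tensor_one_right \<phi>}"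

text \<open>Homomorphisms of algebraic groups from the additive group of \<open>I \<otimes> I \<otimes> I\<close> to the multiplicative
  group \<open>1 + I \<otimes> I \<otimes> I\<close>.  The ground field being algebraically closed, these are the regular
  maps on points that are group homomorphisms.  Being extensional makes them determined by
  their values on \<open>I \<otimes> I \<otimes> I\<close>.\<close>

definition unipotent_hom :: "(('g, 'k) form3 \<Rightarrow> ('g, 'k) form3) \<Rightarrow> bool" where
  "unipotent_hom E \<longleftrightarrow>
     E \<in> extensional (tensor3 aug_ideal) \<and>
     E ` tensor3 aug_ideal \<subseteq> {one3 + \<tau> |\<tau>. \<tau> \<in> tensor3 aug_ideal} \<and>
     regular_map_on (tensor3 aug_ideal) E \<and>
     (\<forall>\<phi>\<in>tensor3 aug_ideal. \<forall>\<psi>\<in>tensor3 aug_ideal. E (\<phi> + \<psi>) = mult3 (E \<phi>) (E \<psi>))"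

definition truncated_exp :: "('g, 'k) form3 \<Rightarrow> ('g, 'k) form3" where
  "truncated_exp T = (\<Sum>j<p. fscale (inverse (of_nat (fact j))) (power3 T j))"

definition exp_hom :: "('g, 'k) form3 \<Rightarrow> ('g, 'k) form3" where
  "exp_hom = (THE E. unipotent_hom E \<and>
     (\<forall>a\<in>aug_ideal. \<forall>b\<in>aug_ideal. \<forall>c\<in>aug_ideal. E (pure3 a b c) = truncated_exp (pure3 a b c)))"

end

end

theory Submission
  imports Defs
begin

text \<open>A linear form on the restricted enveloping algebra is a function on words that respects the
  relators, and the product of the dual becomes the shuffle product. On the shuffle algebra
  \<open>f \<mapsto> (w \<mapsto> f (x w))\<close> is a derivation for each letter \<open>x\<close>; a function on words is determined by
  its value at the empty word and its derivatives. Hence \<open>f\<^sup>p\<close> vanishes if \<open>f\<close> has no constant term,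
  and there is an exponential characterised by \<open>E(\<phi>)([]) = 1\<close> and \<open>\<partial>\<^sub>x E(\<phi>) = \<partial>\<^sub>x \<phi> E(\<phi>)\<close>, with
  respect to the first tensor factor. It is a homomorphism, natural in the coefficient ring,
  injective on functions without constant term, and agrees with the truncated exponential on
  decomposable tensors of the augmentation ideal. Deconcatenation \<open>\<Delta>\<close> in the first factor
  satisfies \<open>\<Delta> E(\<phi>) = E(\<Delta> \<phi>) (1 \<otimes> E(\<phi>))\<close>, so the pentagon equation for \<open>E(\<phi>)\<close> is the cocycle
  equation for \<open>\<phi>\<close>. Finally \<open>E(\<phi>) = 1 + \<phi>\<close> up to longer words, and as words of bounded length span
  the restricted enveloping algebra, successive approximation shows that \<open>E\<close> is onto
  \<open>1 + I \<otimes> I \<otimes> I\<close>.\<close>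

section \<open>The shuffle algebra\<close>

fun unshuffle_sum :: "('a list \<Rightarrow> 'a list \<Rightarrow> 'r::comm_monoid_add) \<Rightarrow> 'a list \<Rightarrow> 'r" where
  "unshuffle_sum h [] = h [] []"
| "unshuffle_sum h (x # w) =
     unshuffle_sum (\<lambda>u v. h (x # u) v) w + unshuffle_sum (\<lambda>u v. h u (x # v)) w"

lemma unshuffle_sum_add:
  "unshuffle_sum (\<lambda>u v. h u v + h' u v) w = unshuffle_sum h w + unshuffle_sum h' w"
  by (induction w arbitrary: h h') (simp_all add: algebra_simps)

lemma unshuffle_sum_zero [simp]: "unshuffle_sum (\<lambda>u v. 0) w = 0"
  by (induction w) simp_all

lemma unshuffle_sum_additive:
  assumes "\<And>a b. \<theta> (a + b) = \<theta> a + \<theta> b"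
  shows "\<theta> (unshuffle_sum h w) = unshuffle_sum (\<lambda>u v. \<theta> (h u v)) w"
  by (induction w arbitrary: h) (simp_all add: assms)

lemma unshuffle_sum_append:
  "unshuffle_sum h (w @ w') =
     unshuffle_sum (\<lambda>u v. unshuffle_sum (\<lambda>u' v'. h (u @ u') (v @ v')) w') w"
  by (induction w arbitrary: h) simp_all

lemma unshuffle_sum_mult_commute:
  fixes a b :: "'a list \<Rightarrow> 'r::comm_semiring_0"
  shows "unshuffle_sum (\<lambda>u v. a u * b v) w = unshuffle_sum (\<lambda>u v. b u * a v) w"
  by (induction w arbitrary: a b) (simp_all add: algebra_simps)

lemma unshuffle_sum_mult_assoc:
  fixes a b c :: "'a list \<Rightarrow> 'r::semiring_0"
  shows "unshuffle_sum (\<lambda>u v. unshuffle_sum (\<lambda>u v. a u * b v) u * c v) w =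
    unshuffle_sum (\<lambda>u v. a u * unshuffle_sum (\<lambda>u v. b u * c v) v) w"
  by (induction w arbitrary: a b c)
    (simp_all add: distrib_left distrib_right unshuffle_sum_add add.assoc mult.assoc)

lemma unshuffle_sum_one_mult:
  fixes b :: "'a list \<Rightarrow> 'r::semiring_1"
  shows "unshuffle_sum (\<lambda>u v. (if u = [] then 1 else 0) * b v) w = b w"
  by (induction w arbitrary: b) simp_all

lemma unshuffle_sum_replicate:
  fixes h :: "'a list \<Rightarrow> 'a list \<Rightarrow> 'r::semiring_1"
  shows "unshuffle_sum h (replicate n x) =
    (\<Sum>i\<le>n. of_nat (n choose i) * h (replicate i x) (replicate (n - i) x))"
proof (induction n arbitrary: h)
  case (Suc n)
  define T where "T i j = h (replicate i x) (replicate j x)" for i j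
  have "unshuffle_sum h (replicate (Suc n) x) =
      (\<Sum>i\<le>n. of_nat (n choose i) * T (Suc i) (n - i)) +
      (\<Sum>i\<le>n. of_nat (n choose i) * T i (Suc n - i))"
    by (simp add: Suc T_def Suc_diff_le)
  also have "(\<Sum>i\<le>n. of_nat (n choose i) * T i (Suc n - i)) =
      (\<Sum>i\<le>Suc n. of_nat (n choose i) * T i (Suc n - i))"
    by (simp add: binomial_eq_0)
  also have "\<dots> = T 0 (Suc n) + (\<Sum>i\<le>n. of_nat (n choose Suc i) * T (Suc i) (n - i))"
    by (subst sum.atMost_Suc_shift) simp
  also have "(\<Sum>i\<le>n. of_nat (n choose i) * T (Suc i) (n - i)) + \<dots> =
      T 0 (Suc n) + (\<Sum>i\<le>n. of_nat (Suc n choose Suc i) * T (Suc i) (n - i))"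
    by (simp add: algebra_simps sum.distrib)
  also have "\<dots> = (\<Sum>i\<le>Suc n. of_nat (Suc n choose i) * T i (Suc n - i))"
    by (subst sum.atMost_Suc_shift) simp
  finally show ?case
    by (simp only: T_def)
qed simp

lemma unshuffle_sum_replicate_CHAR:
  fixes h :: "'a list \<Rightarrow> 'a list \<Rightarrow> 'r::semiring_1_cancel"
  assumes "prime CHAR('r)"
  shows "unshuffle_sum h (replicate CHAR('r) x) =
    h (replicate CHAR('r) x) [] + h [] (replicate CHAR('r) x)"
proof -
  let ?p = "CHAR('r)"
  have "of_nat (?p choose i) = (0::'r)" if "i \<in> {..?p} - {0, ?p}" for i
    using dvd_choose_prime[of i ?p] assms that of_nat_eq_0_iff_char_dvd by auto
  then have "unshuffle_sum h (replicate ?p x) =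
      (\<Sum>i\<in>{0, ?p}. of_nat (?p choose i) * h (replicate i x) (replicate (?p - i) x))"
    unfolding unshuffle_sum_replicate by (intro sum.mono_neutral_right) auto
  then show ?thesis
    using prime_gt_0_nat[OF assms] by (simp add: add.commute)
qed

typedef ('a, 'r) shuf = "UNIV :: ('a list \<Rightarrow> 'r) set"
  morphisms coef Shuf by simp

lemmas coef_Shuf [simp] = Shuf_inverse[OF UNIV_I]

lemma shuf_eqI: "(\<And>w. coef f w = coef g w) \<Longrightarrow> f = g"
  by (metis coef_inverse ext)

instantiation shuf :: (type, comm_ring_1) comm_ring_1
begin

definition "0 = Shuf (\<lambda>w. 0)"
definition "1 = Shuf (\<lambda>w. if w = [] then 1 else 0)"
definition "f + g = Shuf (\<lambda>w. coef f w + coef g w)"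
definition "f - g = Shuf (\<lambda>w. coef f w - coef g w)"
definition "- f = Shuf (\<lambda>w. - coef f w)"
definition "f * g = Shuf (unshuffle_sum (\<lambda>u v. coef f u * coef g v))"

instance
proof
  fix f g h :: "('a, 'b) shuf"
  show "f * g * h = f * (g * h)"
    by (rule shuf_eqI) (simp add: times_shuf_def unshuffle_sum_mult_assoc)
  show "f * g = g * f"
    by (rule shuf_eqI) (simp add: times_shuf_def unshuffle_sum_mult_commute[of "coef f"])
  show "1 * f = f"
    by (rule shuf_eqI) (simp add: times_shuf_def one_shuf_def unshuffle_sum_one_mult)
  show "(f + g) * h = f * h + g * h"
    by (rule shuf_eqI) (simp add: times_shuf_def plus_shuf_def distrib_right unshuffle_sum_add)
  show "f + g + h = f + (g + h)" "f + g = g + f"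
    by (simp_all add: plus_shuf_def algebra_simps)
  show "0 + f = f" "- f + f = 0" "f - g = f + - g"
    by (rule shuf_eqI; simp add: plus_shuf_def zero_shuf_def uminus_shuf_def minus_shuf_def)+
  have "coef 0 [] \<noteq> (coef 1 [] :: 'b)"
    by (simp add: zero_shuf_def one_shuf_def)
  then show "(0 :: ('a, 'b) shuf) \<noteq> 1"
    by metis
qed

end

lemma coef_simps [simp]:
  "coef 0 w = 0" "coef (f + g) w = coef f w + coef g w"
  "coef (f - g) w = coef f w - coef g w" "coef (- f) w = - coef f w"
  by (simp_all add: zero_shuf_def plus_shuf_def minus_shuf_def uminus_shuf_def)

lemma coef_one: "coef 1 w = (if w = [] then 1 else 0)"
  by (simp add: one_shuf_def)

lemma coef_mult: "coef (f * g) w = unshuffle_sum (\<lambda>u v. coef f u * coef g v) w"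
  by (simp add: times_shuf_def)

lemma coef_mult_Nil [simp]: "coef (f * g) [] = coef f [] * coef g []"
  by (simp add: coef_mult)

lemma coef_power_Nil [simp]: "coef (f ^ n) [] = coef f [] ^ n"
  by (induction n) (simp_all add: coef_one)

lemma coef_sum: "coef (\<Sum>i\<in>S. f i) w = (\<Sum>i\<in>S. coef (f i) w)"
  by (induction S rule: infinite_finite_induct) simp_all

definition shuf_deriv :: "'a \<Rightarrow> ('a, 'r) shuf \<Rightarrow> ('a, 'r) shuf" where
  "shuf_deriv x f = Shuf (\<lambda>w. coef f (x # w))"

lemma coef_shuf_deriv: "coef (shuf_deriv x f) w = coef f (x # w)"
  by (simp add: shuf_deriv_def)

lemma shuf_eq_iff_deriv:
  "f = g \<longleftrightarrow> coef f [] = coef g [] \<and> (\<forall>x. shuf_deriv x f = shuf_deriv x g)"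
proof (intro iffI conjI allI)
  assume eq: "coef f [] = coef g [] \<and> (\<forall>x. shuf_deriv x f = shuf_deriv x g)"
  show "f = g"
  proof (rule shuf_eqI)
    fix w show "coef f w = coef g w"
      by (cases w) (use eq in \<open>simp_all flip: coef_shuf_deriv\<close>)
  qed
qed simp_all

lemma shuf_eq_derivI:
  "coef f [] = coef g [] \<Longrightarrow> (\<And>x. shuf_deriv x f = shuf_deriv x g) \<Longrightarrow> f = g"
  by (rule iffD2[OF shuf_eq_iff_deriv]) blast

lemma shuf_deriv_simps [simp]:
  "shuf_deriv x 0 = 0" "shuf_deriv x 1 = 0"
  "shuf_deriv x (f + g) = shuf_deriv x f + shuf_deriv x g"
  "shuf_deriv x (f - g) = shuf_deriv x f - shuf_deriv x g" "shuf_deriv x (- f) = - shuf_deriv x f"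
  by (rule shuf_eqI; simp add: coef_shuf_deriv coef_one)+

lemma shuf_deriv_mult: "shuf_deriv x (f * g) = shuf_deriv x f * g + f * shuf_deriv x g"
  by (rule shuf_eqI) (simp add: coef_shuf_deriv coef_mult)

lemma coef_mult_Cons:
  "coef (f * g) (x # w) = coef (shuf_deriv x f * g) w + coef (f * shuf_deriv x g) w"
  by (simp add: shuf_deriv_mult flip: coef_shuf_deriv)

lemma shuf_deriv_sum: "shuf_deriv x (\<Sum>i\<in>S. f i) = (\<Sum>i\<in>S. shuf_deriv x (f i))"
  by (induction S rule: infinite_finite_induct) simp_all

lemma shuf_deriv_power: "shuf_deriv x (f ^ n) = of_nat n * f ^ (n - 1) * shuf_deriv x f"
proof (induction n)
  case (Suc n)
  then show ?case
    by (cases n) (simp_all add: shuf_deriv_mult algebra_simps)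
qed simp

definition shuf_const :: "'r::zero \<Rightarrow> ('a, 'r) shuf" where
  "shuf_const r = Shuf (\<lambda>w. if w = [] then r else 0)"

lemma coef_shuf_const: "coef (shuf_const r) w = (if w = [] then r else 0)"
  by (simp add: shuf_const_def)

lemma shuf_deriv_const [simp]: "shuf_deriv x (shuf_const r :: ('a, 'r::comm_ring_1) shuf) = 0"
  by (rule shuf_eqI) (simp add: coef_shuf_deriv coef_shuf_const)

lemma shuf_const_simps:
  "shuf_const (r + s) = (shuf_const r + shuf_const s :: ('a, 'r::comm_ring_1) shuf)"
  "shuf_const (r * s) = (shuf_const r * shuf_const s :: ('a, 'r::comm_ring_1) shuf)"
  "shuf_const 1 = (1 :: ('a, 'r::comm_ring_1) shuf)"
  "shuf_const 0 = (0 :: ('a, 'r::comm_ring_1) shuf)"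
  by (rule shuf_eq_derivI; simp add: coef_shuf_const coef_one shuf_deriv_mult)+

lemma shuf_const_power: "shuf_const (r ^ n) = (shuf_const r ^ n :: ('a, 'r::comm_ring_1) shuf)"
  by (induction n) (simp_all add: shuf_const_simps)

lemma coef_shuf_const_mult: "coef (shuf_const r * f) w = r * coef f w"
  by (induction w arbitrary: f)
    (simp_all add: coef_mult_Cons coef_shuf_const coef_shuf_deriv)

lemma coef_mult_shuf_const: "coef (f * shuf_const r) w = coef f w * r"
  by (simp add: mult.commute[of _ "shuf_const r"] coef_shuf_const_mult mult.commute[of r])

lemma shuf_eq_const_iff: "f = shuf_const (coef f []) \<longleftrightarrow> (\<forall>x. shuf_deriv x f = 0)"
  by (subst shuf_eq_iff_deriv) (simp add: coef_shuf_const)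

lemma of_nat_shuf: "(of_nat n :: ('a, 'r::comm_ring_1) shuf) = shuf_const (of_nat n)"
  by (induction n) (simp_all add: shuf_const_simps)

lemma shuf_power_CHAR_eq_0:
  fixes f :: "('a, 'r::comm_ring_1) shuf"
  assumes "CHAR('r) > 0" "coef f [] = 0"
  shows "f ^ CHAR('r) = 0"
  by (rule shuf_eq_derivI)
    (simp_all add: assms zero_power shuf_deriv_power of_nat_shuf shuf_const_simps)


section \<open>Functoriality and deconcatenation\<close>

definition ring_map :: "('r::comm_ring_1 \<Rightarrow> 's::comm_ring_1) \<Rightarrow> bool" where
  "ring_map \<theta> \<longleftrightarrow> \<theta> 1 = 1 \<and> (\<forall>a b. \<theta> (a + b) = \<theta> a + \<theta> b) \<and> (\<forall>a b. \<theta> (a * b) = \<theta> a * \<theta> b)"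

lemma ring_mapD:
  assumes "ring_map \<theta>"
  shows "\<theta> 0 = 0" "\<theta> 1 = 1" "\<theta> (a + b) = \<theta> a + \<theta> b" "\<theta> (a * b) = \<theta> a * \<theta> b"
proof -
  show "\<theta> 1 = 1" and add: "\<theta> (a + b) = \<theta> a + \<theta> b" and "\<theta> (a * b) = \<theta> a * \<theta> b" for a b
    using assms by (simp_all add: ring_map_def)
  show "\<theta> 0 = 0"
    using add[of 0 0] by simp
qed

definition shuf_map :: "('r \<Rightarrow> 's) \<Rightarrow> ('a, 'r) shuf \<Rightarrow> ('a, 's) shuf" where
  "shuf_map \<theta> f = Shuf (\<lambda>w. \<theta> (coef f w))"

lemma coef_shuf_map [simp]: "coef (shuf_map \<theta> f) w = \<theta> (coef f w)"
  by (simp add: shuf_map_def)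

lemma shuf_deriv_map: "shuf_deriv x (shuf_map \<theta> f) = shuf_map \<theta> (shuf_deriv x f)"
  by (rule shuf_eqI) (simp add: coef_shuf_deriv)

lemma ring_map_shuf_map:
  assumes "ring_map \<theta>"
  shows "ring_map (shuf_map \<theta> :: ('a, 'r::comm_ring_1) shuf \<Rightarrow> ('a, 's::comm_ring_1) shuf)"
  unfolding ring_map_def
proof (intro conjI allI)
  show "shuf_map \<theta> 1 = 1"
    by (rule shuf_eqI) (simp add: coef_one ring_mapD[OF assms])
  show "shuf_map \<theta> (f + g) = shuf_map \<theta> f + shuf_map \<theta> g" for f g :: "('a, 'r) shuf"
    by (rule shuf_eqI) (simp add: ring_mapD[OF assms])
  show "shuf_map \<theta> (f * g) = shuf_map \<theta> f * shuf_map \<theta> g" for f g :: "('a, 'r) shuf"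
    by (rule shuf_eqI) (simp add: coef_mult unshuffle_sum_additive[of \<theta>] ring_mapD[OF assms])
qed

lemma ring_map_shuf_const: "ring_map (shuf_const :: 'r::comm_ring_1 \<Rightarrow> ('a, 'r) shuf)"
  by (simp add: ring_map_def shuf_const_simps)

definition deconc :: "('a, 'r) shuf \<Rightarrow> ('a, ('a, 'r) shuf) shuf" where
  "deconc f = Shuf (\<lambda>u. Shuf (\<lambda>v. coef f (u @ v)))"

lemma coef_deconc [simp]: "coef (coef (deconc f) u) v = coef f (u @ v)"
  by (simp add: deconc_def)

lemma coef_deconc_Nil [simp]: "coef (deconc f) [] = f"
  by (rule shuf_eqI) simp

lemma shuf_deriv_deconc: "shuf_deriv x (deconc f) = deconc (shuf_deriv x f)"
  by (intro shuf_eqI) (simp add: coef_shuf_deriv)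

lemma deconc_add: "deconc (f + g) = deconc f + deconc g"
  by (intro shuf_eqI) simp

lemma deconc_mult:
  fixes f g :: "('a, 'r::comm_ring_1) shuf"
  shows "deconc (f * g) = deconc f * deconc g"
proof (rule shuf_eqI)
  fix u show "coef (deconc (f * g)) u = coef (deconc f * deconc g) u"
  proof (induction u arbitrary: f g)
    case (Cons x u)
    have "coef (deconc (f * g)) (x # u) =
        coef (deconc (shuf_deriv x f * g)) u + coef (deconc (f * shuf_deriv x g)) u"
      by (simp add: shuf_deriv_deconc shuf_deriv_mult deconc_add flip: coef_shuf_deriv)
    then show ?case
      by (simp add: Cons.IH coef_mult_Cons shuf_deriv_deconc)
  qed simp
qed

lemma ring_map_deconc:
  "ring_map (deconc :: ('a, 'r::comm_ring_1) shuf \<Rightarrow> ('a, ('a, 'r) shuf) shuf)"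
  unfolding ring_map_def
proof (intro conjI allI)
  show "deconc 1 = (1 :: ('a, ('a, 'r) shuf) shuf)"
    by (intro shuf_eqI) (simp add: coef_one)
qed (simp_all add: deconc_add deconc_mult)


section \<open>The exponential of the shuffle algebra\<close>

text \<open>The intended value of \<open>exp_mult \<phi> w g\<close> is the coefficient of \<open>exp \<phi> * g\<close> at \<open>w\<close>; carrying the
  factor \<open>g\<close> along makes the differential equation of the exponential a primitive recursion.\<close>

primrec exp_mult :: "('a, 'r::comm_ring_1) shuf \<Rightarrow> 'a list \<Rightarrow> ('a, 'r) shuf \<Rightarrow> 'r" where
  "exp_mult \<phi> [] g = coef g []"
| "exp_mult \<phi> (x # w) g = exp_mult \<phi> w (shuf_deriv x g + shuf_deriv x \<phi> * g)"

definition shuf_exp :: "('a, 'r::comm_ring_1) shuf \<Rightarrow> ('a, 'r) shuf" where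
  "shuf_exp \<phi> = Shuf (\<lambda>w. exp_mult \<phi> w 1)"

lemma exp_mult_add: "exp_mult \<phi> w (g + h) = exp_mult \<phi> w g + exp_mult \<phi> w h"
proof (induction w arbitrary: g h)
  case (Cons x w)
  let ?D = "\<lambda>g. shuf_deriv x g + shuf_deriv x \<phi> * g"
  have "?D (g + h) = ?D g + ?D h"
    by (simp add: algebra_simps)
  then show ?case
    by (simp only: exp_mult.simps Cons.IH)
qed simp

lemma coef_exp_mult_mult: "coef (Shuf (\<lambda>w. exp_mult \<phi> w g) * h) w = exp_mult \<phi> w (g * h)"
proof (induction w arbitrary: g h)
  case (Cons x w)
  let ?D = "shuf_deriv x g + shuf_deriv x \<phi> * g"
  have "shuf_deriv x (Shuf (\<lambda>w. exp_mult \<phi> w g)) = Shuf (\<lambda>w. exp_mult \<phi> w ?D)"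
    by (rule shuf_eqI) (simp add: coef_shuf_deriv)
  then have "coef (Shuf (\<lambda>w. exp_mult \<phi> w g) * h) (x # w) =
      exp_mult \<phi> w (?D * h + g * shuf_deriv x h)"
    by (simp add: coef_mult_Cons Cons.IH flip: exp_mult_add)
  then show ?case
    by (simp add: shuf_deriv_mult algebra_simps)
qed simp

lemma shuf_deriv_exp: "shuf_deriv x (shuf_exp \<phi>) = shuf_deriv x \<phi> * shuf_exp \<phi>"
proof (rule shuf_eqI)
  fix w
  have "coef (shuf_exp \<phi> * shuf_deriv x \<phi>) w = exp_mult \<phi> w (shuf_deriv x \<phi>)"
    by (simp add: shuf_exp_def coef_exp_mult_mult)
  then show "coef (shuf_deriv x (shuf_exp \<phi>)) w = coef (shuf_deriv x \<phi> * shuf_exp \<phi>) w"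
    by (simp add: shuf_exp_def coef_shuf_deriv mult.commute)
qed

lemma coef_shuf_exp_Nil [simp]: "coef (shuf_exp \<phi>) [] = 1"
  by (simp add: shuf_exp_def coef_one)

lemma shuf_exp_minus_inverse: "shuf_exp \<phi> * shuf_exp (- \<phi>) = 1"
  by (rule shuf_eq_derivI)
    (simp_all add: coef_one shuf_deriv_mult shuf_deriv_exp algebra_simps)

lemma shuf_exp_mult_minus_cancel [simp]: "shuf_exp \<phi> * (shuf_exp (- \<phi>) * f) = f"
  by (simp add: shuf_exp_minus_inverse flip: mult.assoc)

lemma shuf_exp_unique_solution:
  assumes "\<And>x. shuf_deriv x f = shuf_deriv x \<phi> * f"
  shows "f = shuf_exp \<phi> * shuf_const (coef f [])"
proof -
  let ?g = "shuf_exp (- \<phi>) * f"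
  have "?g = shuf_const (coef ?g [])"
    unfolding shuf_eq_const_iff by (simp add: shuf_deriv_mult shuf_deriv_exp assms algebra_simps)
  then have "shuf_exp \<phi> * ?g = shuf_exp \<phi> * shuf_const (coef f [])"
    by simp
  then show ?thesis
    by simp
qed

lemma shuf_exp_eqI:
  assumes "coef f [] = 1" "\<And>x. shuf_deriv x f = shuf_deriv x \<phi> * f"
  shows "f = shuf_exp \<phi>"
  using shuf_exp_unique_solution[OF assms(2)] assms(1) by (simp add: shuf_const_simps)

lemma shuf_exp_add: "shuf_exp (\<phi> + \<psi>) = shuf_exp \<phi> * shuf_exp \<psi>"
  by (rule shuf_exp_eqI[symmetric]) (simp_all add: shuf_deriv_mult shuf_deriv_exp algebra_simps)

lemma shuf_exp_zero [simp]: "shuf_exp 0 = 1"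
  by (rule shuf_exp_eqI[symmetric]) (simp_all add: coef_one)

lemma mult_right_cancel_invertible:
  fixes c :: "'r::monoid_mult"
  assumes "c * d = 1"
  shows "a * c = b * c \<longleftrightarrow> a = b"
  by (metis assms mult.assoc mult.right_neutral)

lemma shuf_exp_eq_iff:
  "shuf_exp \<phi> = shuf_exp \<psi> \<longleftrightarrow> (\<forall>x. shuf_deriv x \<phi> = shuf_deriv x \<psi>)"
proof
  assume "shuf_exp \<phi> = shuf_exp \<psi>"
  then have "shuf_deriv x \<phi> * shuf_exp \<phi> = shuf_deriv x \<psi> * shuf_exp \<phi>" for x
    using shuf_deriv_exp[of x \<phi>] shuf_deriv_exp[of x \<psi>] by simp
  then show "\<forall>x. shuf_deriv x \<phi> = shuf_deriv x \<psi>"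
    by (simp add: mult_right_cancel_invertible[OF shuf_exp_minus_inverse])
next
  assume "\<forall>x. shuf_deriv x \<phi> = shuf_deriv x \<psi>"
  then show "shuf_exp \<phi> = shuf_exp \<psi>"
    by (intro shuf_exp_eqI) (simp_all add: shuf_deriv_exp)
qed

lemma shuf_map_exp:
  assumes "ring_map \<theta>"
  shows "shuf_map \<theta> (shuf_exp \<phi>) = shuf_exp (shuf_map \<theta> \<phi>)"
  by (rule shuf_exp_eqI)
    (simp_all add: shuf_deriv_map shuf_deriv_exp ring_mapD[OF assms]
      ring_mapD[OF ring_map_shuf_map[OF assms]])

lemma deconc_shuf_exp: "deconc (shuf_exp \<phi>) = shuf_exp (deconc \<phi>) * shuf_const (shuf_exp \<phi>)"
proof -
  have "shuf_deriv x (deconc (shuf_exp \<phi>)) = shuf_deriv x (deconc \<phi>) * deconc (shuf_exp \<phi>)" for x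
    by (simp add: shuf_deriv_deconc shuf_deriv_exp deconc_mult)
  from shuf_exp_unique_solution[OF this] show ?thesis
    by simp
qed

lemma shuf_exp_pentagon_iff:
  fixes f :: "('a, 's::comm_ring_1) shuf" and \<theta>\<^sub>1 \<theta>\<^sub>2 \<theta>\<^sub>3 :: "'s \<Rightarrow> ('a, 's) shuf"
  assumes maps: "ring_map \<theta>\<^sub>1" "ring_map \<theta>\<^sub>2" "ring_map \<theta>\<^sub>3" and "coef f [] = 0"
  shows "shuf_map \<theta>\<^sub>1 (shuf_exp f) * deconc (shuf_exp f) =
      shuf_const (shuf_exp f) * shuf_map \<theta>\<^sub>2 (shuf_exp f) * shuf_map \<theta>\<^sub>3 (shuf_exp f) \<longleftrightarrow>
    shuf_map \<theta>\<^sub>1 f + deconc f = shuf_const f + shuf_map \<theta>\<^sub>2 f + shuf_map \<theta>\<^sub>3 f"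
    (is "?pentagon \<longleftrightarrow> ?cocycle")
proof -
  let ?c = "shuf_const (shuf_exp f) :: ('a, ('a, 's) shuf) shuf"
  let ?l = "shuf_map \<theta>\<^sub>1 f + deconc f" and ?r = "shuf_map \<theta>\<^sub>2 f + shuf_map \<theta>\<^sub>3 f"
  have "?c * shuf_const (shuf_exp (- f)) = 1"
    by (simp only: shuf_exp_minus_inverse shuf_const_simps(3) flip: shuf_const_simps(2))
  then have cancel: "g * ?c = h * ?c \<longleftrightarrow> g = h" for g h
    by (rule mult_right_cancel_invertible)
  have "?pentagon \<longleftrightarrow> shuf_exp ?l * ?c = shuf_exp ?r * ?c"
    by (simp add: shuf_map_exp maps deconc_shuf_exp shuf_exp_add mult_ac)
  also have "\<dots> \<longleftrightarrow> (\<forall>x. shuf_deriv x ?l = shuf_deriv x ?r)"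
    by (simp only: cancel shuf_exp_eq_iff)
  also have "\<dots> \<longleftrightarrow> ?cocycle"
    unfolding shuf_eq_iff_deriv[of ?l]
    by (simp add: coef_shuf_const \<open>coef f [] = 0\<close> maps[THEN ring_mapD(1)])
  finally show ?thesis .
qed

lemma power_mult_shuf_deriv_eq_0:
  fixes f :: "('a, 'r::comm_ring_1) shuf"
  assumes "s ^ Suc n = 0"
  shows "(f * shuf_const s) ^ n * shuf_deriv x (f * shuf_const s) = 0"
proof -
  have "(f * shuf_const s) ^ n * shuf_deriv x (f * shuf_const s) =
      f ^ n * shuf_deriv x f * shuf_const (s ^ Suc n)"
    by (simp add: shuf_deriv_mult power_mult_distrib shuf_const_simps shuf_const_power mult_ac)
  then show ?thesis
    by (simp only: assms shuf_const_simps mult_zero_right)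
qed

lemma truncated_exp_eq_shuf_exp:
  fixes T :: "('a, 'r::comm_ring_1) shuf" and c :: "nat \<Rightarrow> 'r"
  assumes "c 0 = 1" and c: "\<And>j. j < n \<Longrightarrow> of_nat (Suc j) * c (Suc j) = c j"
    and "coef T [] = 0" and T: "\<And>x. T ^ n * shuf_deriv x T = 0"
  shows "(\<Sum>j\<le>n. shuf_const (c j) * T ^ j) = shuf_exp T"
proof (rule shuf_exp_eqI)
  show "coef (\<Sum>j\<le>n. shuf_const (c j) * T ^ j) [] = 1"
    by (simp add: coef_sum coef_shuf_const \<open>c 0 = 1\<close> \<open>coef T [] = 0\<close> power_0_left if_distrib
      cong: if_cong)
  fix x
  have coeff: "shuf_const (c (Suc j)) * of_nat (Suc j) = (shuf_const (c j) :: ('a, 'r) shuf)"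
    if "j < n" for j
    using c[OF that] by (simp only: of_nat_shuf mult.commute flip: shuf_const_simps)
  have "shuf_deriv x (\<Sum>j\<le>n. shuf_const (c j) * T ^ j) =
      (\<Sum>j<Suc n. shuf_const (c j) * (of_nat j * T ^ (j - 1) * shuf_deriv x T))"
    by (simp add: shuf_deriv_sum shuf_deriv_mult shuf_deriv_power lessThan_Suc_atMost)
  also have "\<dots> = (\<Sum>j<n. shuf_const (c (Suc j)) * of_nat (Suc j) * T ^ j * shuf_deriv x T)"
    by (subst sum.lessThan_Suc_shift) (simp add: mult.assoc)
  also have "\<dots> = (\<Sum>j<n. shuf_const (c j) * T ^ j * shuf_deriv x T)"
    by (intro sum.cong) (simp_all only: lessThan_iff coeff)
  also have "\<dots> = (\<Sum>j<n. shuf_const (c j) * T ^ j) * shuf_deriv x T +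
      shuf_const (c n) * (T ^ n * shuf_deriv x T)"
    by (simp add: T sum_distrib_right)
  also have "\<dots> = shuf_deriv x T * (\<Sum>j\<le>n. shuf_const (c j) * T ^ j)"
    by (simp add: algebra_simps flip: lessThan_Suc_atMost)
  finally show "shuf_deriv x (\<Sum>j\<le>n. shuf_const (c j) * T ^ j) =
      shuf_deriv x T * (\<Sum>j\<le>n. shuf_const (c j) * T ^ j)" .
qed


section \<open>The filtration by word length\<close>

definition vanishes_below :: "nat \<Rightarrow> ('a, 'r::zero) shuf \<Rightarrow> bool" where
  "vanishes_below n f \<longleftrightarrow> (\<forall>w. length w < n \<longrightarrow> coef f w = 0)"

lemma vanishes_below_Suc:
  "vanishes_below (Suc n) f \<longleftrightarrow> coef f [] = 0 \<and> (\<forall>x. vanishes_below n (shuf_deriv x f))"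
  unfolding vanishes_below_def
  by (auto simp: coef_shuf_deriv All_less_Suc2 length_Suc_conv less_Suc_eq_0_disj)

lemma vanishes_below_shuf_deriv: "vanishes_below n f \<Longrightarrow> vanishes_below (n - 1) (shuf_deriv x f)"
  by (simp add: vanishes_below_def coef_shuf_deriv)

lemma vanishes_below_mult:
  fixes f :: "('a, 'r::comm_ring_1) shuf"
  assumes "vanishes_below m f" "vanishes_below n g"
  shows "vanishes_below (m + n) (f * g)"
  unfolding vanishes_below_def
proof (intro allI impI)
  fix w :: "'a list" assume "length w < m + n"
  with assms show "coef (f * g) w = 0"
  proof (induction w arbitrary: f g m n)
    case Nil
    then show ?case
      by (auto simp: vanishes_below_def)
  next
    case (Cons x w)
    have "coef (shuf_deriv x f * g) w = 0"
      using Cons.prems by (intro Cons.IH[of "m - 1" _ n] vanishes_below_shuf_deriv) auto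
    moreover have "coef (f * shuf_deriv x g) w = 0"
      using Cons.prems by (intro Cons.IH[of m _ "n - 1"] vanishes_below_shuf_deriv) auto
    ultimately show ?case
      by (simp add: coef_mult_Cons)
  qed
qed

lemma vanishes_below_mult_left:
  fixes f :: "('a, 'r::comm_ring_1) shuf"
  shows "vanishes_below n g \<Longrightarrow> vanishes_below n (f * g)"
  using vanishes_below_mult[of 0 f n g] by (simp add: vanishes_below_def)

lemma shuf_exp_first_order:
  fixes \<phi> :: "('a, 'r::comm_ring_1) shuf"
  assumes "vanishes_below (Suc n) \<phi>"
  shows "vanishes_below (Suc (Suc n)) (shuf_exp \<phi> - 1 - \<phi>)"
proof -
  have Nil: "coef \<phi> [] = 0" and deriv: "vanishes_below n (shuf_deriv x \<phi>)" for x
    using assms by (simp_all add: vanishes_below_Suc)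
  have zeroth: "vanishes_below (Suc n) (shuf_exp \<phi> - 1)"
    using vanishes_below_mult_left[OF deriv, where f = "shuf_exp \<phi>"]
    by (simp add: vanishes_below_Suc coef_one shuf_deriv_exp mult.commute)
  have "shuf_deriv x (shuf_exp \<phi> - 1 - \<phi>) = shuf_deriv x \<phi> * (shuf_exp \<phi> - 1)" for x
    by (simp add: shuf_deriv_exp algebra_simps)
  then show ?thesis
    using zeroth by (subst vanishes_below_Suc) (simp add: coef_one Nil vanishes_below_mult_left)
qed

lemma shuf_exp_correction:
  fixes f :: "('a, 'r::comm_ring_1) shuf"
  assumes approx: "vanishes_below (Suc n) (f - shuf_exp \<phi>)"
    and quotient: "1 + \<tau> = shuf_exp (- \<phi>) * f"
  shows "vanishes_below (Suc (Suc n)) (f - shuf_exp (\<phi> + \<tau>))"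
proof -
  have "\<tau> = shuf_exp (- \<phi>) * (f - shuf_exp \<phi>)"
    using quotient shuf_exp_minus_inverse[of \<phi>] by (simp add: algebra_simps)
  then have "vanishes_below (Suc n) \<tau>"
    by (simp add: vanishes_below_mult_left approx)
  then have "vanishes_below (Suc (Suc n)) (- shuf_exp \<phi> * (shuf_exp \<tau> - 1 - \<tau>))"
    by (intro vanishes_below_mult_left shuf_exp_first_order)
  also have "- shuf_exp \<phi> * (shuf_exp \<tau> - 1 - \<tau>) = shuf_exp \<phi> * (1 + \<tau>) - shuf_exp (\<phi> + \<tau>)"
    by (simp add: shuf_exp_add algebra_simps)
  also have "shuf_exp \<phi> * (1 + \<tau>) = f"
    by (simp add: quotient)
  finally show ?thesis .
qed


section \<open>Polynomial dependence on parameters\<close>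

definition function_subalgebra :: "('x \<Rightarrow> 'r::comm_ring_1) set \<Rightarrow> bool" where
  "function_subalgebra P \<longleftrightarrow> (\<forall>c. (\<lambda>_. c) \<in> P) \<and>
     (\<forall>r\<in>P. \<forall>s\<in>P. (\<lambda>t. r t + s t) \<in> P) \<and> (\<forall>r\<in>P. \<forall>s\<in>P. (\<lambda>t. r t * s t) \<in> P)"

lemma function_subalgebraD:
  assumes "function_subalgebra P"
  shows "(\<lambda>_. c) \<in> P" "r \<in> P \<Longrightarrow> s \<in> P \<Longrightarrow> (\<lambda>t. r t + s t) \<in> P"
    "r \<in> P \<Longrightarrow> s \<in> P \<Longrightarrow> (\<lambda>t. r t * s t) \<in> P"
  using assms by (auto simp: function_subalgebra_def)

lemma function_subalgebra_sum:
  assumes P: "function_subalgebra P" and "\<And>i. i \<in> S \<Longrightarrow> r i \<in> P"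
  shows "(\<lambda>t. \<Sum>i\<in>S. r i t) \<in> P"
  using assms(2)
  by (induction S rule: infinite_finite_induct) (simp_all add: function_subalgebraD[OF P])

definition coefficientwise :: "('x \<Rightarrow> 'r) set \<Rightarrow> ('x \<Rightarrow> ('a, 'r) shuf) set" where
  "coefficientwise P = {H. \<forall>w. (\<lambda>t. coef (H t) w) \<in> P}"

lemma coefficientwise_shuf_deriv:
  "H \<in> coefficientwise P \<Longrightarrow> (\<lambda>t. shuf_deriv x (H t)) \<in> coefficientwise P"
  by (simp add: coefficientwise_def coef_shuf_deriv)

lemma function_subalgebra_coefficientwise:
  assumes P: "function_subalgebra P"
  shows "function_subalgebra (coefficientwise P :: ('x \<Rightarrow> ('a, 'r::comm_ring_1) shuf) set)"
proof -
  have "(\<lambda>t. coef (F t * G t) w) \<in> P"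
    if "F \<in> coefficientwise P" "G \<in> coefficientwise P" for F G :: "'x \<Rightarrow> ('a, 'r) shuf" and w
    using that
  proof (induction w arbitrary: F G)
    case Nil
    then show ?case
      by (simp add: coefficientwise_def function_subalgebraD[OF P])
  next
    case (Cons x w)
    then show ?case
      by (simp add: coef_mult_Cons coefficientwise_shuf_deriv function_subalgebraD[OF P])
  qed
  then show ?thesis
    by (auto simp: function_subalgebra_def coefficientwise_def function_subalgebraD[OF P])
qed

lemma coefficientwise_shuf_exp:
  assumes P: "function_subalgebra P" and H: "H \<in> coefficientwise P"
  shows "(\<lambda>t. shuf_exp (H t)) \<in> coefficientwise P"
proof -
  note closed = function_subalgebraD[OF function_subalgebra_coefficientwise[OF P]]
  have "(\<lambda>t. exp_mult (H t) w (G t)) \<in> P" if "G \<in> coefficientwise P" for G w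
    using that
  proof (induction w arbitrary: G)
    case Nil
    then show ?case
      by (simp add: coefficientwise_def)
  next
    case (Cons x w)
    then show ?case
      by (simp add: Cons.IH closed coefficientwise_shuf_deriv H)
  qed
  from this[OF closed(1)] show ?thesis
    by (simp add: coefficientwise_def shuf_exp_def)
qed


section \<open>Linear functionals on monoid algebras\<close>

definition lin_ext :: "('m \<Rightarrow> 'k::field) \<Rightarrow> ('m \<Rightarrow>\<^sub>0 'k) \<Rightarrow> 'k" where
  "lin_ext f t = (\<Sum>m\<in>Poly_Mapping.keys t. Poly_Mapping.lookup t m * f m)"

lemma lin_ext_superset:
  assumes "finite S" "Poly_Mapping.keys t \<subseteq> S"
  shows "lin_ext f t = (\<Sum>m\<in>S. Poly_Mapping.lookup t m * f m)"
  unfolding lin_ext_def using assms by (intro sum.mono_neutral_left) (auto simp: in_keys_iff)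

lemma lin_ext_add: "lin_ext f (s + t) = lin_ext f s + lin_ext f t"
proof -
  let ?S = "Poly_Mapping.keys s \<union> Poly_Mapping.keys t"
  have "Poly_Mapping.keys (s + t) \<subseteq> ?S"
    by (rule keys_add)
  then show ?thesis
    by (simp add: lin_ext_superset[of ?S] lookup_add algebra_simps sum.distrib)
qed

lemma lin_ext_zero [simp]: "lin_ext f 0 = 0"
  by (simp add: lin_ext_def)

lemma lin_ext_diff: "lin_ext f (s - t) = lin_ext f s - lin_ext f t"
  using lin_ext_add[of f "s - t" t] by simp

lemma lin_ext_sum: "lin_ext f (\<Sum>i\<in>S. t i) = (\<Sum>i\<in>S. lin_ext f (t i))"
  by (induction S rule: infinite_finite_induct) (simp_all add: lin_ext_add)

lemma lin_ext_single [simp]: "lin_ext f (Poly_Mapping.single m c) = c * f m"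
  by (cases "c = 0") (simp_all add: lin_ext_def)

lemma lin_ext_one: "lin_ext f 1 = f 0"
  by (simp flip: single_one)

lemma lin_ext_fun_add: "lin_ext (\<lambda>m. f m + g m) t = lin_ext f t + lin_ext g t"
  by (simp add: lin_ext_def algebra_simps sum.distrib)

lemma lin_ext_fun_zero [simp]: "lin_ext (\<lambda>m. 0) t = 0"
  by (simp add: lin_ext_def)

lemma lin_ext_commute:
  "lin_ext (\<lambda>m. lin_ext (\<lambda>n. f m n) t) s = lin_ext (\<lambda>n. lin_ext (\<lambda>m. f m n) s) t"
  unfolding lin_ext_def sum_distrib_left by (subst sum.swap) (simp add: mult.left_commute)

lemma lin_ext_unshuffle_sum:
  "lin_ext (\<lambda>m. unshuffle_sum (h m) w) t = unshuffle_sum (\<lambda>u v. lin_ext (\<lambda>m. h m u v) t) w"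
  by (induction w arbitrary: h) (simp_all add: lin_ext_fun_add)

lemma lin_ext_indicator: "lin_ext (\<lambda>m. if m = a then 1 else 0) t = Poly_Mapping.lookup t a"
proof -
  have "lin_ext (\<lambda>m. if m = a then 1 else 0) t =
      (\<Sum>m\<in>Poly_Mapping.keys t. if m = a then Poly_Mapping.lookup t m else 0)"
    by (simp add: lin_ext_def if_distrib cong: if_cong)
  then show ?thesis
    by (subst (asm) sum.delta) (auto simp: in_keys_iff)
qed

lemma poly_mapping_eq_sum_single:
  "t = (\<Sum>m\<in>Poly_Mapping.keys t. Poly_Mapping.single m (Poly_Mapping.lookup t m))"
proof (rule poly_mapping_eqI)
  fix m
  have "Poly_Mapping.lookup t m =
      (\<Sum>n\<in>Poly_Mapping.keys t. if m = n then Poly_Mapping.lookup t n else 0)"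
    by (subst sum.delta') (auto simp: in_keys_iff)
  then show "Poly_Mapping.lookup t m = Poly_Mapping.lookup
      (\<Sum>m\<in>Poly_Mapping.keys t. Poly_Mapping.single m (Poly_Mapping.lookup t m)) m"
    by (simp add: lookup_sum lookup_single when_def eq_commute)
qed

lemma lin_ext_mult:
  fixes s t :: "'m::monoid_add \<Rightarrow>\<^sub>0 'k::field"
  shows "lin_ext f (s * t) = lin_ext (\<lambda>m. lin_ext (\<lambda>n. f (m + n)) t) s"
proof -
  let ?K = Poly_Mapping.keys and ?L = Poly_Mapping.lookup
  have "s * t = (\<Sum>m\<in>?K s. Poly_Mapping.single m (?L s m)) *
      (\<Sum>n\<in>?K t. Poly_Mapping.single n (?L t n))"
    by (simp flip: poly_mapping_eq_sum_single)
  also have "\<dots> = (\<Sum>m\<in>?K s. \<Sum>n\<in>?K t. Poly_Mapping.single (m + n) (?L s m * ?L t n))"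
    by (simp add: sum_product mult_single)
  also have "lin_ext f \<dots> = (\<Sum>m\<in>?K s. ?L s m * (\<Sum>n\<in>?K t. ?L t n * f (m + n)))"
    by (simp add: lin_ext_sum sum_distrib_left mult.assoc)
  finally show ?thesis
    by (simp add: lin_ext_def)
qed

lemma lin_ext_scalar_mult: "lin_ext f (scalar c * t) = c * lin_ext f t"
  by (simp add: scalar_def lin_ext_mult)

lemma scalar_mult_commute: "s * scalar c = scalar c * (s :: 'm::monoid_add \<Rightarrow>\<^sub>0 'k::field)"
  unfolding scalar_def
  by (subst (1 2) poly_mapping_eq_sum_single[of s])
    (simp add: sum_distrib_left sum_distrib_right mult_single mult.commute)

lemma linear_eq_lin_ext:
  fixes \<phi> :: "('m::monoid_add \<Rightarrow>\<^sub>0 'k::field) \<Rightarrow> 'k"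
  assumes add: "\<And>s t. \<phi> (s + t) = \<phi> s + \<phi> t"
    and scale: "\<And>c t. \<phi> (scalar c * t) = c * \<phi> t"
  shows "\<phi> t = lin_ext (\<lambda>m. \<phi> (Poly_Mapping.single m 1)) t"
proof -
  have zero: "\<phi> 0 = 0"
    using scale[of 0 0] by simp
  have single: "\<phi> (Poly_Mapping.single m c) = c * \<phi> (Poly_Mapping.single m 1)" for m c
    using scale[of c "Poly_Mapping.single m 1"] by (simp add: scalar_def mult_single)
  have "\<phi> (\<Sum>m\<in>S. Poly_Mapping.single m (a m)) = (\<Sum>m\<in>S. a m * \<phi> (Poly_Mapping.single m 1))" for S a
    by (induction S rule: infinite_finite_induct) (simp_all add: zero add single[of _ "a _"])
  from this[of "Poly_Mapping.lookup t" "Poly_Mapping.keys t"] show ?thesis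
    by (simp only: lin_ext_def flip: poly_mapping_eq_sum_single)
qed

primrec letters :: "'a word \<Rightarrow> 'a list" where
  "letters (Word w) = w"

lemma Word_letters [simp]: "Word (letters w) = w"
  by (cases w) simp

lemma letters_plus [simp]: "letters (v + w) = letters v @ letters w"
  by (cases v; cases w) simp

lemma letters_eq_Nil_iff [simp]: "letters w = [] \<longleftrightarrow> w = 0"
  by (cases w) (simp add: zero_word_def)

lemma gen_power: "gen x ^ n = Poly_Mapping.single (Word (replicate n x)) 1"
  by (induction n) (simp_all add: gen_def mult_single zero_word_def flip: single_one)

lemma lin_ext_gen:
  "lin_ext f (gen x) = f (Word [x])" "lin_ext f (gen x * gen y) = f (Word [x, y])"
  "lin_ext f (gen x ^ n) = f (Word (replicate n x))"
  unfolding gen_power by (simp_all add: gen_def mult_single)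

lemma lin_ext_comult_word:
  "lin_ext h (comult_word (Word w)) = unshuffle_sum (\<lambda>u v. h (Word u, Word v)) w"
proof (induction w arbitrary: h)
  case Nil
  then show ?case
    by (simp add: lin_ext_one zero_prod_def zero_word_def)
next
  case (Cons x w)
  have "lin_ext (\<lambda>n. h ((Word [x], 0) + n)) (comult_word (Word w)) =
      unshuffle_sum (\<lambda>u v. h (Word (x # u), Word v)) w"
    "lin_ext (\<lambda>n. h ((0, Word [x]) + n)) (comult_word (Word w)) =
      unshuffle_sum (\<lambda>u v. h (Word u, Word (x # v))) w"
    by (simp_all only: Cons.IH) (simp_all add: zero_word_def)
  then show ?case
    by (simp add: distrib_right lin_ext_add lin_ext_mult)
qed

lemma lin_ext_free_comult:
  "lin_ext h (free_comult t) =
     lin_ext (\<lambda>w. unshuffle_sum (\<lambda>u v. h (Word u, Word v)) (letters w)) t"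
proof -
  have "lin_ext h (comult_word w) = unshuffle_sum (\<lambda>u v. h (Word u, Word v)) (letters w)" for w
    using lin_ext_comult_word[of h "letters w"] by simp
  then show ?thesis
    by (simp add: free_comult_def lin_ext_sum lin_ext_scalar_mult) (simp add: lin_ext_def)
qed


section \<open>Permuted words and repeated letters\<close>

lemma eq_of_mset_eq_if_swap:
  assumes swap: "\<And>u x y v. length (u @ x # y # v) = n \<Longrightarrow> g (u @ x # y # v) = g (u @ y # x # v)"
    and "mset v = mset w" "length w = n"
  shows "g v = g w"
proof -
  have front: "g (t @ u @ x # v) = g (t @ x # u @ v)" if "length (t @ u @ x # v) = n" for t u v x
    using that
  proof (induction u arbitrary: t)
    case (Cons y u)
    then show ?case
      using Cons.IH[of "t @ [y]"] swap[of t y x "u @ v"] by simp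
  qed simp
  have "g (t @ v) = g (t @ w)" if "mset v = mset w" "length (t @ w) = n" for t v w
    using that
  proof (induction v arbitrary: t w)
    case (Cons x v)
    then obtain w1 w2 where w: "w = w1 @ x # w2"
      by (metis list.set_intros(1) mset_eq_setD split_list)
    then have "g (t @ x # v) = g (t @ x # w1 @ w2)"
      using Cons.IH[of "w1 @ w2" "t @ [x]"] Cons.prems by simp
    also have "\<dots> = g (t @ w)"
      using front[of t w1 x w2] Cons.prems w by simp
    finally show ?case .
  qed simp
  from this[of v w "[]"] show ?thesis
    using assms by simp
qed

lemma pigeonhole_count_list:
  assumes "finite B" "set w \<subseteq> B" "card B * m < length w"
  shows "\<exists>b\<in>B. m < count_list w b"
proof (rule ccontr)
  assume "\<not> ?thesis"
  then have "sum (count_list w) B \<le> card B * m"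
    using sum_bounded_above[of B "count_list w" m] by force
  then show False
    using assms sum_count_set[of w B] by simp
qed


section \<open>Tensor powers of spaces of functions\<close>

interpretation fun_space: vector_space fscale
  by (rule vector_space_fscale)

lemma sum_fun_apply: "(\<Sum>i\<in>S. f i) x = (\<Sum>i\<in>S. f i x)"
  by (induction S rule: infinite_finite_induct) simp_all

lemma subspace_tensor3: "fun_space.subspace (tensor3 V)"
  by (simp add: tensor3_def fspan_def)

lemmas tensor3_closed = fun_space.subspace_0[OF subspace_tensor3]
  fun_space.subspace_add[OF subspace_tensor3] fun_space.subspace_scale[OF subspace_tensor3]
  fun_space.subspace_neg[OF subspace_tensor3] fun_space.subspace_diff[OF subspace_tensor3]
  fun_space.subspace_sum[OF subspace_tensor3]

lemma pure3_in_tensor3: "a \<in> V \<Longrightarrow> b \<in> V \<Longrightarrow> c \<in> V \<Longrightarrow> pure3 a b c \<in> tensor3 V"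
  unfolding tensor3_def fspan_def by (rule fun_space.span_base) blast

lemma pure3_zero: "pure3 0 b c = 0"
  by (auto simp: pure3_def fun_eq_iff)

lemma pure3_fscale: "pure3 (fscale k a) b c = fscale k (pure3 a b c)"
  by (auto simp: pure3_def fscale_def mult.assoc)

lemma tensor3_subset:
  assumes "fun_space.subspace W" "\<And>a b c. a \<in> V \<Longrightarrow> b \<in> V \<Longrightarrow> c \<in> V \<Longrightarrow> pure3 a b c \<in> W"
  shows "tensor3 V \<subseteq> W"
  unfolding tensor3_def fspan_def using assms by (intro fun_space.span_minimal) auto

lemma tensor3_induct [consumes 2, case_names zero pure_add]:
  assumes "F \<in> tensor3 V" and V: "fun_space.subspace V"
    and zero: "P 0"
    and pure_add: "\<And>a b c G. a \<in> V \<Longrightarrow> b \<in> V \<Longrightarrow> c \<in> V \<Longrightarrow> G \<in> tensor3 V \<Longrightarrow> P G \<Longrightarrow> P (pure3 a b c + G)"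
  shows "P F"
proof -
  have "F \<in> tensor3 V \<and> P F"
    using assms(1) unfolding tensor3_def fspan_def
  proof (induction rule: fun_space.span_induct_alt)
    case base
    show ?case
      using zero fun_space.span_zero by blast
  next
    case (step k T G)
    then obtain a b c where T: "T = pure3 a b c" and abc: "a \<in> V" "b \<in> V" "c \<in> V"
      by blast
    have "fscale k a \<in> V"
      using V abc(1) by (rule fun_space.subspace_scale)
    then show ?case
      using step abc pure_add[of "fscale k a" b c G]
        tensor3_closed(2)[OF pure3_in_tensor3, of "fscale k a" V b c G]
      by (simp only: T pure3_fscale flip: tensor3_def fspan_def)
  qed
  then show ?thesis ..
qed

definition regular_functions_on :: "('x \<Rightarrow> 'k::field) set \<Rightarrow> (('x \<Rightarrow> 'k) \<Rightarrow> 'k) set" where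
  "regular_functions_on V = {h. \<exists>r\<in>poly_functions. \<forall>f\<in>V. h f = r f}"

lemma regular_map_on_iff: "regular_map_on V F \<longleftrightarrow> (\<forall>y. (\<lambda>f. F f y) \<in> regular_functions_on V)"
  by (simp add: regular_map_on_def regular_functions_on_def)

lemma coord_regular: "(\<lambda>f. f x) \<in> regular_functions_on V"
  unfolding regular_functions_on_def by (auto intro: bexI[OF _ poly_functions.coord])

lemma regular_functions_on_cong:
  "g \<in> regular_functions_on V \<Longrightarrow> (\<And>f. f \<in> V \<Longrightarrow> h f = g f) \<Longrightarrow> h \<in> regular_functions_on V"
  by (auto simp: regular_functions_on_def)

lemma function_subalgebra_regular: "function_subalgebra (regular_functions_on V)"
proof -
  have "(\<lambda>f. r f + s f) \<in> regular_functions_on V" "(\<lambda>f. r f * s f) \<in> regular_functions_on V"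
    if "r \<in> regular_functions_on V" "s \<in> regular_functions_on V" for r s
    using that
    by (force simp: regular_functions_on_def intro: poly_functions.add poly_functions.mult)+
  then show ?thesis
    using poly_functions.const by (force simp: function_subalgebra_def regular_functions_on_def)
qed

lemma function_subalgebra_lin_ext:
  assumes "function_subalgebra P" "\<And>m. r m \<in> P"
  shows "(\<lambda>t. lin_ext (\<lambda>m. r m t) s) \<in> P"
  unfolding lin_ext_def using assms by (intro function_subalgebra_sum function_subalgebraD)


context restricted_lie_algebra
begin

section \<open>Linear forms as functions on words\<close>

lemma prime_char: "prime p"
  using prime_CHAR_semidom[where 'a = 'k] char_eq char_pos by simp

definition word_class :: "'g list \<Rightarrow> ('g, 'k) residue_class" where
  "word_class w = coset (Poly_Mapping.single (Word w) 1)"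

lemma word_class_in_uea [simp]: "word_class w \<in> uea"
  by (simp add: word_class_def uea_def)

lemma uea_one_eq: "uea_one = word_class []"
  by (simp add: uea_one_def word_class_def flip: zero_word_def single_one)

lemma uea_mult_word_class: "uea_mult (word_class u) (word_class v) = word_class (u @ v)"
  by (simp add: word_class_def uea_mult_coset mult_single)

definition respects_relators :: "('g list \<Rightarrow> 'k) \<Rightarrow> bool" where
  "respects_relators g \<longleftrightarrow> (\<forall>r\<in>relators. \<forall>u v. lin_ext (\<lambda>n. g (u @ letters n @ v)) r = 0)"

lemma relatorsE:
  assumes "r \<in> relators"
  obtains (add) x y where "r = gen (x + y) - (gen x + gen y)"
    | (scale) c x where "r = gen (scale c x) - scalar c * gen x"
    | (bracket) x y where "r = gen (br x y) - (gen x * gen y - gen y * gen x)"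
    | (power) x where "r = gen (pmap x) - gen x ^ p"
  using assms unfolding relators_def by blast

lemma respects_relators_iff:
  "respects_relators g \<longleftrightarrow>
     (\<forall>x y u v. g (u @ (x + y) # v) = g (u @ x # v) + g (u @ y # v)) \<and>
     (\<forall>c x u v. g (u @ scale c x # v) = c * g (u @ x # v)) \<and>
     (\<forall>x y u v. g (u @ br x y # v) = g (u @ x # y # v) - g (u @ y # x # v)) \<and>
     (\<forall>x u v. g (u @ pmap x # v) = g (u @ replicate p x @ v))"
proof -
  have "(\<forall>r\<in>relators. Q r) \<longleftrightarrow> (\<forall>x y. Q (gen (x + y) - (gen x + gen y))) \<and>
     (\<forall>c x. Q (gen (scale c x) - scalar c * gen x)) \<and>
     (\<forall>x y. Q (gen (br x y) - (gen x * gen y - gen y * gen x))) \<and>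
     (\<forall>x. Q (gen (pmap x) - gen x ^ p))" for Q
    unfolding relators_def by blast
  then show ?thesis
    by (simp add: respects_relators_def lin_ext_diff lin_ext_add lin_ext_scalar_mult lin_ext_gen)
qed

text \<open>The relators are primitive, so that the ideal they generate is a coideal; for \<open>x\<^sup>p\<close> this is
  the vanishing of the inner binomial coefficients.\<close>

lemma relator_primitive:
  assumes "r \<in> relators"
  shows "lin_ext (\<lambda>n. unshuffle_sum h (letters n)) r =
    lin_ext (\<lambda>n. h (letters n) []) r + lin_ext (\<lambda>n. h [] (letters n)) r"
  using assms
proof (cases rule: relatorsE)
  case (add x y)
  show ?thesis
    by (simp add: add lin_ext_diff lin_ext_add lin_ext_gen)
next
  case (scale c x)
  show ?thesis
    by (simp add: scale lin_ext_diff lin_ext_scalar_mult lin_ext_gen algebra_simps)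
next
  case (bracket x y)
  show ?thesis
    by (simp add: bracket lin_ext_diff lin_ext_gen)
next
  case (power x)
  have "unshuffle_sum h (replicate p x) = h (replicate p x) [] + h [] (replicate p x)"
    using unshuffle_sum_replicate_CHAR[where 'r = 'k] prime_char char_eq by simp
  then show ?thesis
    by (simp add: power lin_ext_diff lin_ext_gen)
qed

lemma respects_relators_unshuffle_sum:
  assumes left: "\<And>v. respects_relators (\<lambda>u. h u v)" and right: "\<And>u. respects_relators (h u)"
  shows "respects_relators (unshuffle_sum h)"
  unfolding respects_relators_def
proof (intro ballI allI)
  fix r u v assume r: "r \<in> relators"
  have vanish: "lin_ext (\<lambda>n. h (a @ letters n @ c) b) r = 0"
    "lin_ext (\<lambda>n. h b (a @ letters n @ c)) r = 0" for a b c
    using left right r by (simp_all add: respects_relators_def)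
  have "lin_ext (\<lambda>n. unshuffle_sum h (u @ letters n @ v)) r =
      unshuffle_sum (\<lambda>a b. lin_ext (\<lambda>n. unshuffle_sum (\<lambda>c d.
        unshuffle_sum (\<lambda>e f. h (a @ c @ e) (b @ d @ f)) v) (letters n)) r) u"
    by (simp add: unshuffle_sum_append lin_ext_unshuffle_sum)
  also have "\<dots> = unshuffle_sum (\<lambda>a b. 0) u"
    by (simp add: relator_primitive[OF r] lin_ext_unshuffle_sum vanish)
  finally show "lin_ext (\<lambda>n. unshuffle_sum h (u @ letters n @ v)) r = 0"
    by simp
qed

lemma respects_relators_indicator_Nil: "respects_relators (\<lambda>w. if w = [] then 1 else 0)"
  using char_pos by (simp add: respects_relators_iff)

lemma respects_relators_translate:
  assumes "respects_relators g"
  shows "respects_relators (\<lambda>w. g (u @ w))" "respects_relators (\<lambda>w. g (w @ u))"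
proof -
  have vanish: "lin_ext (\<lambda>n. g (u' @ letters n @ v')) r = 0" if "r \<in> relators" for r u' v'
    using assms that by (simp add: respects_relators_def)
  show "respects_relators (\<lambda>w. g (u @ w))" "respects_relators (\<lambda>w. g (w @ u))"
    using vanish[of _ "u @ _"] vanish[of _ _ "_ @ u"] by (simp_all add: respects_relators_def)
qed

lemma lin_ext_ideal_eq_0:
  assumes "t \<in> ideal_gen relators" "respects_relators g"
  shows "lin_ext (\<lambda>w. g (letters w)) t = 0"
  using assms
proof (induction arbitrary: g)
  case (base r)
  then have "lin_ext (\<lambda>n. g ([] @ letters n @ [])) r = 0"
    unfolding respects_relators_def by blast
  then show ?case
    by simp
next
  case (lmult s r)
  have "lin_ext (\<lambda>n. g (letters (m + n))) s = 0" for m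
    using lmult.IH[OF respects_relators_translate(1)[OF lmult.prems, of "letters m"]] by simp
  then show ?case
    by (simp add: lin_ext_mult)
next
  case (rmult s r)
  have "lin_ext (\<lambda>n. g (letters (n + m))) s = 0" for m
    using rmult.IH[OF respects_relators_translate(2)[OF rmult.prems, of "letters m"]] by simp
  then show ?case
    by (simp add: lin_ext_mult lin_ext_commute[of _ r s])
qed (simp_all add: lin_ext_add)

lemma subspace_dual: "fun_space.subspace dual"
  by (auto simp: fun_space.subspace_def dual_def fscale_def algebra_simps)

lemma dual_closed:
  assumes "f \<in> dual"
  shows "(\<lambda>x. f x * c) \<in> dual" "(\<lambda>x. c * f x) \<in> dual"
  using fun_space.subspace_scale[OF subspace_dual assms] by (simp_all add: fscale_def mult.commute)

lemma dual_coset: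
  assumes "f \<in> dual"
  shows "f (coset t) = lin_ext (\<lambda>w. f (word_class (letters w))) t"
  unfolding word_class_def Word_letters
  using assms by (intro linear_eq_lin_ext) (auto simp: dual_def)

lemma dual_outside: "f \<in> dual \<Longrightarrow> X \<notin> uea \<Longrightarrow> f X = 0"
  by (simp add: dual_def)

lemma dual_eqD:
  assumes "f \<in> dual" "g \<in> dual" "\<And>w. f (word_class w) = g (word_class w)"
  shows "f X = g X"
proof (cases "X \<in> uea")
  case True
  then obtain t where "X = coset t"
    by (auto simp: uea_def)
  then show ?thesis
    using assms by (simp add: dual_coset)
qed (simp add: dual_outside assms)

lemma dual_respects_relators:
  assumes "f \<in> dual"
  shows "respects_relators (\<lambda>w. f (word_class w))"
  unfolding respects_relators_def
proof (intro ballI allI)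
  fix r u v assume "r \<in> relators"
  let ?t = "Poly_Mapping.single (Word u) 1 * r * Poly_Mapping.single (Word v) 1"
  have "?t \<in> ideal_gen relators"
    by (intro ideal_gen.lmult ideal_gen.rmult ideal_gen.base) fact
  then have "coset ?t = coset 0"
    by (simp add: coset_eq_iff)
  then have "f (coset ?t) = 0"
    using dual_coset[OF assms, of 0] by simp
  then show "lin_ext (\<lambda>n. f (word_class (u @ letters n @ v))) r = 0"
    by (simp add: dual_coset[OF assms] lin_ext_mult)
qed

definition form_of_words :: "('g list \<Rightarrow> 'k) \<Rightarrow> ('g, 'k) form1" where
  "form_of_words g = (\<lambda>X. if X \<in> uea then lin_ext (\<lambda>w. g (letters w)) (rep X) else 0)"

lemma
  assumes "respects_relators g"
  shows form_of_words_dual: "form_of_words g \<in> dual"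
    and form_of_words_word_class: "form_of_words g (word_class w) = g w"
proof -
  have coset: "form_of_words g (coset t) = lin_ext (\<lambda>w. g (letters w)) t" for t
    using lin_ext_ideal_eq_0[OF rep_coset assms, of t]
    by (simp add: form_of_words_def uea_def lin_ext_diff)
  then show "form_of_words g \<in> dual"
    by (simp add: dual_def lin_ext_add lin_ext_scalar_mult) (simp add: form_of_words_def)
  show "form_of_words g (word_class w) = g w"
    by (simp add: word_class_def coset)
qed

lemma uea_counit_eq: "uea_counit = form_of_words (\<lambda>w. if w = [] then 1 else 0)"
  by (rule ext) (simp add: uea_counit_def form_of_words_def lin_ext_indicator)

lemma uea_counit_dual: "uea_counit \<in> dual"
  and uea_counit_word_class: "uea_counit (word_class w) = (if w = [] then 1 else 0)"
  unfolding uea_counit_eq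
  by (simp_all add: form_of_words_dual form_of_words_word_class respects_relators_indicator_Nil)

lemma pair_comult_eq:
  "pair_comult \<beta> = form_of_words (unshuffle_sum (\<lambda>u v. \<beta> (word_class u) (word_class v)))"
proof
  fix X
  let ?h = "\<lambda>(v, w). \<beta> (coset (Poly_Mapping.single v 1)) (coset (Poly_Mapping.single w 1))"
  have "pair_comult \<beta> X = (if X \<in> uea then lin_ext ?h (free_comult (rep X)) else 0)"
    by (simp add: pair_comult_def lin_ext_def case_prod_beta)
  then show "pair_comult \<beta> X =
      form_of_words (unshuffle_sum (\<lambda>u v. \<beta> (word_class u) (word_class v))) X"
    by (simp add: form_of_words_def lin_ext_free_comult word_class_def)
qed

lemma
  assumes "\<And>y. (\<lambda>x. \<beta> x y) \<in> dual" "\<And>x. \<beta> x \<in> dual"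
  shows pair_comult_dual: "pair_comult \<beta> \<in> dual"
    and pair_comult_word_class:
      "pair_comult \<beta> (word_class w) = unshuffle_sum (\<lambda>u v. \<beta> (word_class u) (word_class v)) w"
proof -
  have "respects_relators (unshuffle_sum (\<lambda>u v. \<beta> (word_class u) (word_class v)))"
    by (intro respects_relators_unshuffle_sum dual_respects_relators
        dual_respects_relators[where f = "\<lambda>x. \<beta> x _"] assms)
  then show "pair_comult \<beta> \<in> dual"
    "pair_comult \<beta> (word_class w) = unshuffle_sum (\<lambda>u v. \<beta> (word_class u) (word_class v)) w"
    unfolding pair_comult_eq by (simp_all add: form_of_words_dual form_of_words_word_class)
qed

lemma pair_comult_add:
  "pair_comult (\<lambda>x y. \<beta> x y + \<gamma> x y) X = pair_comult \<beta> X + pair_comult \<gamma> X"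
  by (simp add: pair_comult_def case_prod_beta algebra_simps sum.distrib)

lemma pair_comult_zero [simp]: "pair_comult (\<lambda>x y. 0) X = 0"
  by (simp add: pair_comult_def)

lemma pair_comult_parameter:
  assumes M: "fun_space.subspace M" and "\<And>a b. (\<lambda>y. \<beta> y a b) \<in> M"
  shows "(\<lambda>y. pair_comult (\<beta> y) X) \<in> M"
proof (cases "X \<in> uea")
  case True
  let ?K = "Poly_Mapping.keys (free_comult (rep X))"
    and ?L = "Poly_Mapping.lookup (free_comult (rep X))"
  have "(\<lambda>y. pair_comult (\<beta> y) X) = (\<Sum>m\<in>?K. fscale (?L m)
      (\<lambda>y. \<beta> y (coset (Poly_Mapping.single (fst m) 1)) (coset (Poly_Mapping.single (snd m) 1))))"
    using True by (auto simp: pair_comult_def case_prod_beta fscale_def sum_fun_apply)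
  then show ?thesis
    using assms by (simp add: fun_space.subspace_sum fun_space.subspace_scale)
next
  case False
  then show ?thesis
    using fun_space.subspace_0[OF M] by (simp add: pair_comult_def zero_fun_def)
qed

lemma dual_uea_mult:
  assumes "f \<in> dual"
  shows "(\<lambda>x. if x \<in> uea \<and> y \<in> uea then f (uea_mult x y) else 0) \<in> dual" (is "?left \<in> dual")
    and "(\<lambda>x. if y \<in> uea \<and> x \<in> uea then f (uea_mult y x) else 0) \<in> dual" (is "?right \<in> dual")
proof -
  have add: "f (coset (s + t)) = f (coset s) + f (coset t)"
    and scale: "f (coset (scalar c * t)) = c * f (coset t)" for s t c
    using assms by (simp_all add: dual_def)
  have central: "s * (scalar c * t) = scalar c * (s * t)" for s t :: "('g, 'k) free_algebra" and c
    by (metis mult.assoc scalar_mult_commute)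
  have "?left \<in> dual \<and> ?right \<in> dual"
  proof (cases "y \<in> uea")
    case True
    then obtain t where y: "y = coset t"
      by (auto simp: uea_def)
    have in_uea: "coset s \<in> uea" for s
      by (simp add: uea_def)
    show ?thesis
      unfolding dual_def y
      by (auto simp: in_uea uea_mult_coset distrib_left distrib_right add mult.assoc central scale)
  qed (simp add: fun_space.subspace_0[OF subspace_dual, unfolded zero_fun_def])
  then show "?left \<in> dual" "?right \<in> dual"
    by blast+
qed


section \<open>Multilinear forms and the shuffle algebra\<close>

text \<open>Tensoring with the dual on the left turns \<open>M\<close>, \<open>m\<close>, \<open>h\<close> into \<open>prod_forms M\<close>, \<open>prod_mult m\<close>,
  \<open>prod_shuf h\<close>; starting from the dual, two and three such steps yield its third and fourth tensor
  power.  The last clause of \<open>represents\<close>, that \<open>m\<close> preserves linear dependence on a parameter in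
  either argument, is what makes the induction step go through.\<close>

definition represents ::
  "('b \<Rightarrow> 'k) set \<Rightarrow> (('b \<Rightarrow> 'k) \<Rightarrow> ('b \<Rightarrow> 'k) \<Rightarrow> 'b \<Rightarrow> 'k) \<Rightarrow> (('b \<Rightarrow> 'k) \<Rightarrow> 'r::comm_ring_1) \<Rightarrow> bool"
where
  "represents M m h \<longleftrightarrow> fun_space.subspace M \<and> inj_on h M \<and>
     (\<forall>F G. h (\<lambda>y. F y + G y) = h F + h G) \<and>
     (\<forall>F\<in>M. \<forall>G\<in>M. m F G \<in> M \<and> h (m F G) = h F * h G) \<and>
     (\<forall>F G y. (\<forall>z. (\<lambda>x. F x z) \<in> dual) \<longrightarrow> (\<lambda>x. m (F x) G y) \<in> dual \<and> (\<lambda>x. m G (F x) y) \<in> dual)"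

lemma representsD:
  assumes "represents M m h"
  shows "fun_space.subspace M" "inj_on h M" "h (\<lambda>y. F y + G y) = h F + h G"
    "F \<in> M \<Longrightarrow> G \<in> M \<Longrightarrow> m F G \<in> M" "F \<in> M \<Longrightarrow> G \<in> M \<Longrightarrow> h (m F G) = h F * h G"
    "(\<And>z. (\<lambda>x. H x z) \<in> dual) \<Longrightarrow> (\<lambda>x. m (H x) G y) \<in> dual"
    "(\<And>z. (\<lambda>x. H x z) \<in> dual) \<Longrightarrow> (\<lambda>x. m G (H x) y) \<in> dual"
  using assms by (simp_all add: represents_def)

definition prod_forms :: "('b \<Rightarrow> 'k) set \<Rightarrow> (('g, 'k) residue_class \<times> 'b \<Rightarrow> 'k) set" where
  "prod_forms M = {F. (\<forall>x. (\<lambda>y. F (x, y)) \<in> M) \<and> (\<forall>y. (\<lambda>x. F (x, y)) \<in> dual)}"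

definition prod_mult :: "(('b \<Rightarrow> 'k) \<Rightarrow> ('b \<Rightarrow> 'k) \<Rightarrow> 'b \<Rightarrow> 'k) \<Rightarrow>
    (('g, 'k) residue_class \<times> 'b \<Rightarrow> 'k) \<Rightarrow> (('g, 'k) residue_class \<times> 'b \<Rightarrow> 'k) \<Rightarrow>
    (('g, 'k) residue_class \<times> 'b \<Rightarrow> 'k)" where
  "prod_mult m F G =
     (\<lambda>(x, y). pair_comult (\<lambda>x1 x2. m (\<lambda>y. F (x1, y)) (\<lambda>y. G (x2, y)) y) x)"

definition prod_shuf ::
  "(('b \<Rightarrow> 'k) \<Rightarrow> 'r) \<Rightarrow> (('g, 'k) residue_class \<times> 'b \<Rightarrow> 'k) \<Rightarrow> ('g, 'r) shuf" where
  "prod_shuf h F = Shuf (\<lambda>u. h (\<lambda>y. F (word_class u, y)))"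

lemma coef_prod_shuf [simp]: "coef (prod_shuf h F) u = h (\<lambda>y. F (word_class u, y))"
  by (simp add: prod_shuf_def)

lemma prod_formsD:
  assumes "F \<in> prod_forms M"
  shows "(\<lambda>y. F (x, y)) \<in> M" "(\<lambda>x. F (x, y)) \<in> dual"
  using assms by (simp_all add: prod_forms_def)

lemma subspace_prod_forms:
  assumes "fun_space.subspace M"
  shows "fun_space.subspace (prod_forms M)"
  using assms subspace_dual unfolding prod_forms_def fun_space.subspace_def
  by (simp add: fscale_def plus_fun_def zero_fun_def)

lemma inj_on_prod_shuf:
  assumes "represents M m h"
  shows "inj_on (prod_shuf h) (prod_forms M)"
proof (rule inj_onI)
  fix F G assume F: "F \<in> prod_forms M" and G: "G \<in> prod_forms M"
    and eq: "prod_shuf h F = prod_shuf h G"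
  have slice: "(\<lambda>y. F (word_class u, y)) = (\<lambda>y. G (word_class u, y))" for u
    using arg_cong[OF eq, of "\<lambda>f. coef f u"]
    by (intro inj_onD[OF representsD(2)[OF assms]])
      (simp_all add: prod_formsD[OF F] prod_formsD[OF G])
  have "F (x, y) = G (x, y)" for x y
    using prod_formsD(2)[OF F] prod_formsD(2)[OF G] fun_cong[OF slice] by (rule dual_eqD)
  then show "F = G"
    by auto
qed

lemma
  assumes rep: "represents M m h" and F: "F \<in> prod_forms M" and G: "G \<in> prod_forms M"
  shows prod_mult_closed: "prod_mult m F G \<in> prod_forms M"
    and prod_shuf_mult: "prod_shuf h (prod_mult m F G) = prod_shuf h F * prod_shuf h G"
proof -
  let ?m = "\<lambda>x1 x2. m (\<lambda>y. F (x1, y)) (\<lambda>y. G (x2, y))"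
  have M: "?m x1 x2 \<in> M" for x1 x2
    by (intro representsD(4)[OF rep] prod_formsD F G)
  have dual: "(\<lambda>x1. ?m x1 x2 y) \<in> dual" "(\<lambda>x2. ?m x1 x2 y) \<in> dual" for x1 x2 y
    by (intro representsD(6,7)[OF rep] prod_formsD(2)[OF F] prod_formsD(2)[OF G])+
  show "prod_mult m F G \<in> prod_forms M"
    using pair_comult_parameter[OF representsD(1)[OF rep], of "\<lambda>y x1 x2. ?m x1 x2 y"]
    by (simp add: prod_forms_def prod_mult_def M dual pair_comult_dual)
  show "prod_shuf h (prod_mult m F G) = prod_shuf h F * prod_shuf h G"
  proof (rule shuf_eqI)
    fix u
    have "coef (prod_shuf h (prod_mult m F G)) u =
        h (\<lambda>y. unshuffle_sum (\<lambda>u1 u2. ?m (word_class u1) (word_class u2) y) u)"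
      by (simp add: prod_mult_def pair_comult_word_class dual)
    also have "\<dots> = h (unshuffle_sum (\<lambda>u1 u2. ?m (word_class u1) (word_class u2)) u)"
      by (rule arg_cong[where f = h], rule ext)
        (rule unshuffle_sum_additive[where \<theta> = "\<lambda>f. f _", symmetric], simp)
    also have "\<dots> = unshuffle_sum (\<lambda>u1 u2. h (?m (word_class u1) (word_class u2))) u"
      by (rule unshuffle_sum_additive[where \<theta> = h]) (simp add: plus_fun_def representsD(3)[OF rep])
    also have "\<dots> = coef (prod_shuf h F * prod_shuf h G) u"
      by (simp add: coef_mult representsD(5)[OF rep] prod_formsD F G)
    finally show "coef (prod_shuf h (prod_mult m F G)) u = coef (prod_shuf h F * prod_shuf h G) u" .
  qed
qed

lemma represents_prod:
  fixes M :: "('b \<Rightarrow> 'k) set" and h :: "('b \<Rightarrow> 'k) \<Rightarrow> 'r::comm_ring_1"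
  assumes rep: "represents M m h"
  shows "represents (prod_forms M) (prod_mult m) (prod_shuf h)"
  unfolding represents_def
proof (intro conjI ballI allI impI)
  show "prod_shuf h (\<lambda>y. F y + G y) = prod_shuf h F + prod_shuf h G" for F G
    by (rule shuf_eqI) (simp add: representsD(3)[OF rep])
  fix H :: "('g, 'k) residue_class \<Rightarrow> ('g, 'k) residue_class \<times> 'b \<Rightarrow> 'k" and G z
  assume "\<forall>z. (\<lambda>x. H x z) \<in> dual"
  then show "(\<lambda>x. prod_mult m (H x) G z) \<in> dual" "(\<lambda>x. prod_mult m G (H x) z) \<in> dual"
    unfolding prod_mult_def case_prod_beta
    by (auto intro!: pair_comult_parameter[OF subspace_dual] representsD(6,7)[OF rep])
qed (use rep in \<open>simp_all add: subspace_prod_forms[OF representsD(1)[OF rep]] inj_on_prod_shuf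
      prod_mult_closed prod_shuf_mult\<close>)

definition to_shuf :: "('g, 'k) form1 \<Rightarrow> ('g, 'k) shuf" where
  "to_shuf f = Shuf (\<lambda>w. f (word_class w))"

lemma coef_to_shuf [simp]: "coef (to_shuf f) w = f (word_class w)"
  by (simp add: to_shuf_def)

lemma represents_dual: "represents dual dual_mult to_shuf"
  unfolding represents_def
proof (intro conjI ballI allI impI)
  show "inj_on to_shuf dual"
  proof (intro inj_onI ext)
    fix f g X assume fg: "f \<in> dual" "g \<in> dual" and eq: "to_shuf f = to_shuf g"
    have "f (word_class w) = g (word_class w)" for w
      using arg_cong[OF eq, of "\<lambda>f. coef f w"] by simp
    with fg show "f X = g X"
      by (rule dual_eqD)
  qed
  show "to_shuf (\<lambda>y. f y + g y) = to_shuf f + to_shuf g" for f g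
    by (rule shuf_eqI) simp
  fix f g assume "f \<in> dual" "g \<in> dual"
  then show "dual_mult f g \<in> dual"
    by (simp add: dual_mult_def pair_comult_dual dual_closed)
  show "to_shuf (dual_mult f g) = to_shuf f * to_shuf g"
    using \<open>f \<in> dual\<close> \<open>g \<in> dual\<close>
    by (intro shuf_eqI) (simp add: dual_mult_def pair_comult_word_class dual_closed coef_mult)
next
  fix H :: "('g, 'k) residue_class \<Rightarrow> ('g, 'k) form1" and g X assume "\<forall>Y. (\<lambda>x. H x Y) \<in> dual"
  then show "(\<lambda>x. dual_mult (H x) g X) \<in> dual" "(\<lambda>x. dual_mult g (H x) X) \<in> dual"
    unfolding dual_mult_def
    by (auto intro!: pair_comult_parameter[OF subspace_dual] dual_closed)
qed (rule subspace_dual)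

definition multilinear3 :: "('g, 'k) form3 set" where
  "multilinear3 = prod_forms (prod_forms dual)"

definition multilinear4 :: "('g, 'k) form4 set" where
  "multilinear4 = prod_forms multilinear3"

definition to_shuf3 :: "('g, 'k) form3 \<Rightarrow> ('g, ('g, ('g, 'k) shuf) shuf) shuf" where
  "to_shuf3 = prod_shuf (prod_shuf to_shuf)"

definition to_shuf4 :: "('g, 'k) form4 \<Rightarrow> ('g, ('g, ('g, ('g, 'k) shuf) shuf) shuf) shuf" where
  "to_shuf4 = prod_shuf to_shuf3"

lemma mult3_eq: "mult3 = prod_mult (prod_mult dual_mult)"
  and mult4_eq: "mult4 = prod_mult mult3"
  by (simp_all add: fun_eq_iff mult3_def mult4_def prod_mult_def dual_mult_def)

lemma represents3: "represents multilinear3 mult3 to_shuf3"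
  unfolding multilinear3_def mult3_eq to_shuf3_def by (intro represents_prod represents_dual)

lemma represents4: "represents multilinear4 mult4 to_shuf4"
  unfolding multilinear4_def mult4_eq to_shuf4_def by (intro represents_prod represents3)

lemmas subspace_multilinear3 = representsD(1)[OF represents3]
lemmas subspace_multilinear4 = representsD(1)[OF represents4]
lemmas mult3_multilinear = representsD(4)[OF represents3]
lemmas mult4_multilinear = representsD(4)[OF represents4]
lemmas to_shuf3_mult = representsD(5)[OF represents3]
lemmas to_shuf4_mult = representsD(5)[OF represents4]
lemmas to_shuf3_eqD = inj_onD[OF representsD(2)[OF represents3]]
lemmas to_shuf4_eqD = inj_onD[OF representsD(2)[OF represents4]]

lemma multilinear3_iff:
  "F \<in> multilinear3 \<longleftrightarrow> (\<forall>y z. (\<lambda>x. F (x, y, z)) \<in> dual) \<and>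
     (\<forall>x z. (\<lambda>y. F (x, y, z)) \<in> dual) \<and> (\<forall>x y. (\<lambda>z. F (x, y, z)) \<in> dual)"
  by (auto simp: multilinear3_def prod_forms_def)

lemma multilinear4_iff:
  "F \<in> multilinear4 \<longleftrightarrow> (\<forall>y z w. (\<lambda>x. F (x, y, z, w)) \<in> dual) \<and>
     (\<forall>x z w. (\<lambda>y. F (x, y, z, w)) \<in> dual) \<and> (\<forall>x y w. (\<lambda>z. F (x, y, z, w)) \<in> dual) \<and>
     (\<forall>x y z. (\<lambda>w. F (x, y, z, w)) \<in> dual)"
  by (auto simp: multilinear4_def multilinear3_iff prod_forms_def)

lemma multilinear3D:
  assumes "F \<in> multilinear3"
  shows "(\<lambda>x. F (x, y, z)) \<in> dual" "(\<lambda>y. F (x, y, z)) \<in> dual" "(\<lambda>z. F (x, y, z)) \<in> dual"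
  using assms by (simp_all add: multilinear3_iff)

lemma coef_to_shuf3 [simp]:
  "coef (coef (coef (to_shuf3 F) u) v) w = F (word_class u, word_class v, word_class w)"
  by (simp add: to_shuf3_def)

lemma coef_to_shuf4 [simp]:
  "coef (coef (coef (coef (to_shuf4 F) t) u) v) w =
     F (word_class t, word_class u, word_class v, word_class w)"
  by (simp add: to_shuf4_def)

lemma to_shuf3_simps:
  "to_shuf3 0 = 0" "to_shuf3 (F + G) = to_shuf3 F + to_shuf3 G" "to_shuf3 (- F) = - to_shuf3 F"
  "to_shuf3 (F - G) = to_shuf3 F - to_shuf3 G"
  "to_shuf3 (fscale c F) = shuf_const (shuf_const (shuf_const c)) * to_shuf3 F"
  by (intro shuf_eqI; simp add: fscale_def coef_shuf_const_mult)+

lemma to_shuf3_sum: "to_shuf3 (\<Sum>i\<in>S. F i) = (\<Sum>i\<in>S. to_shuf3 (F i))"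
  by (intro shuf_eqI) (simp add: coef_sum sum_fun_apply)

lemma to_shuf4_add: "to_shuf4 (F + G) = to_shuf4 F + to_shuf4 G"
  by (intro shuf_eqI) simp

lemma pure3_multilinear: "a \<in> dual \<Longrightarrow> b \<in> dual \<Longrightarrow> c \<in> dual \<Longrightarrow> pure3 a b c \<in> multilinear3"
  by (simp add: multilinear3_iff pure3_def dual_closed mult.assoc)

lemma tensor3_dual_multilinear: "tensor3 dual \<subseteq> multilinear3"
  by (intro tensor3_subset subspace_multilinear3 pure3_multilinear)

lemma to_shuf3_pure:
  "to_shuf3 (pure3 a b c) = shuf_map (\<lambda>r. shuf_const (shuf_const r)) (to_shuf a) *
     shuf_const (shuf_map shuf_const (to_shuf b) * shuf_const (to_shuf c))"
  by (intro shuf_eqI)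
    (simp add: pure3_def coef_mult_shuf_const coef_shuf_const_mult mult.assoc)

lemma one3_tensor: "one3 \<in> tensor3 dual"
  by (simp add: one3_def pure3_in_tensor3 uea_counit_dual)

lemma one3_multilinear: "one3 \<in> multilinear3"
  using one3_tensor tensor3_dual_multilinear by blast

lemma to_shuf3_one: "to_shuf3 one3 = 1"
  by (intro shuf_eqI) (simp add: one3_def pure3_def uea_counit_word_class coef_one)

lemma mult3_one_left: "F \<in> multilinear3 \<Longrightarrow> mult3 one3 F = F"
  by (rule to_shuf3_eqD)
    (simp_all add: mult3_multilinear one3_multilinear to_shuf3_mult to_shuf3_one)

lemma mult3_one_right: "F \<in> multilinear3 \<Longrightarrow> mult3 F one3 = F"
  by (rule to_shuf3_eqD)
    (simp_all add: mult3_multilinear one3_multilinear to_shuf3_mult to_shuf3_one)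

lemma mult3_bilinear:
  "mult3 (F + G) H = mult3 F H + mult3 G H" "mult3 H (F + G) = mult3 H F + mult3 H G"
  "mult3 0 H = 0" "mult3 H 0 = 0"
  by (auto simp: mult3_def distrib_left distrib_right pair_comult_add)

lemma tensor3_mult:
  assumes V: "fun_space.subspace V" and mult: "\<And>a b. a \<in> V \<Longrightarrow> b \<in> V \<Longrightarrow> dual_mult a b \<in> V"
    and F: "F \<in> tensor3 V" and G: "G \<in> tensor3 V"
  shows "mult3 F G \<in> tensor3 V"
proof -
  have "mult3 (pure3 a b c) G \<in> tensor3 V" if "a \<in> V" "b \<in> V" "c \<in> V" for a b c
    using G V by (induction rule: tensor3_induct)
      (simp_all only: mult3_bilinear mult3_pure tensor3_closed pure3_in_tensor3 mult that)
  with F V show ?thesis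
    by (induction rule: tensor3_induct) (simp_all only: mult3_bilinear tensor3_closed)
qed

lemma comult_multilinear:
  assumes "F \<in> multilinear3"
  shows "comult1 F \<in> multilinear4" "comult2 F \<in> multilinear4" "comult3 F \<in> multilinear4"
    "tensor_one_left F \<in> multilinear4" "tensor_one_right F \<in> multilinear4"
proof -
  have if_dual: "(\<lambda>x. if P then f x else 0) \<in> dual" if "f \<in> dual" for f P
    using that fun_space.subspace_0[OF subspace_dual] by (cases P) (simp_all add: zero_fun_def)
  note dual = if_dual dual_closed uea_counit_dual multilinear3D[OF assms]
    dual_uea_mult[where f = "\<lambda>t. F (t, _, _)"] dual_uea_mult[where f = "\<lambda>t. F (_, t, _)"]
    dual_uea_mult[where f = "\<lambda>t. F (_, _, t)"]
  show "comult1 F \<in> multilinear4" "comult2 F \<in> multilinear4" "comult3 F \<in> multilinear4"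
    "tensor_one_left F \<in> multilinear4" "tensor_one_right F \<in> multilinear4"
    unfolding multilinear4_iff comult1_def comult2_def comult3_def dual_comult_def
      tensor_one_left_def tensor_one_right_def prod.case
    by (auto intro!: dual)
qed

lemma to_shuf4_comult:
  "to_shuf4 (comult1 F) = deconc (to_shuf3 F)"
  "to_shuf4 (comult2 F) = shuf_map deconc (to_shuf3 F)"
  "to_shuf4 (comult3 F) = shuf_map (shuf_map deconc) (to_shuf3 F)"
  "to_shuf4 (tensor_one_left F) = shuf_const (to_shuf3 F)"
  "to_shuf4 (tensor_one_right F) = shuf_map (shuf_map (shuf_map shuf_const)) (to_shuf3 F)"
  by (intro shuf_eqI; simp add: comult1_def comult2_def comult3_def dual_comult_def
      uea_mult_word_class tensor_one_left_def tensor_one_right_def uea_counit_word_class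
      coef_shuf_const)+


section \<open>The augmentation ideal\<close>

lemma subspace_aug_ideal: "fun_space.subspace aug_ideal"
  using subspace_dual
  by (auto simp: fun_space.subspace_def aug_ideal_def dual_counit_def fscale_def)

lemma aug_idealD: "a \<in> aug_ideal \<Longrightarrow> a \<in> dual" "a \<in> aug_ideal \<Longrightarrow> a (word_class []) = 0"
  by (simp_all add: aug_ideal_def dual_counit_def uea_one_eq)

lemma aug_ideal_mult:
  assumes "a \<in> aug_ideal" "b \<in> aug_ideal"
  shows "dual_mult a b \<in> aug_ideal"
proof -
  have ab: "a \<in> dual" "b \<in> dual"
    using assms by (simp_all add: aug_idealD)
  then have "to_shuf (dual_mult a b) = to_shuf a * to_shuf b"
    by (rule representsD(5)[OF represents_dual])
  then have "dual_mult a b (word_class []) = 0"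
    using assms by (metis aug_idealD(2) coef_mult_Nil coef_to_shuf mult_zero_left)
  then show ?thesis
    using representsD(4)[OF represents_dual ab]
    by (simp add: aug_ideal_def dual_counit_def uea_one_eq)
qed

definition aug_proj :: "('g, 'k) form1 \<Rightarrow> ('g, 'k) form1" where
  "aug_proj a = (\<lambda>x. a x - dual_counit a * dual_one x)"

definition aug_proj3 :: "('g, 'k) form3 \<Rightarrow> ('g, 'k) form3" where
  "aug_proj3 F =
     (\<lambda>(x, y, z). aug_proj (\<lambda>x. aug_proj (\<lambda>y. aug_proj (\<lambda>z. F (x, y, z)) z) y) x)"

lemma aug_proj_in_aug_ideal:
  assumes "a \<in> dual"
  shows "aug_proj a \<in> aug_ideal"
proof -
  have "aug_proj a = a - fscale (dual_counit a) dual_one"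
    by (simp add: aug_proj_def fscale_def fun_eq_iff)
  moreover have "\<dots> \<in> dual"
    by (intro fun_space.subspace_diff fun_space.subspace_scale subspace_dual assms uea_counit_dual)
  ultimately show ?thesis
    by (simp add: aug_ideal_def) (simp add: dual_counit_def fscale_def uea_one_eq
        uea_counit_word_class)
qed

lemma aug_proj3_pure: "aug_proj3 (pure3 a b c) = pure3 (aug_proj a) (aug_proj b) (aug_proj c)"
  by (auto simp: aug_proj3_def aug_proj_def pure3_def dual_counit_def algebra_simps)

lemma aug_proj3_add: "aug_proj3 (F + G) = aug_proj3 F + aug_proj3 G"
  by (auto simp: aug_proj3_def aug_proj_def dual_counit_def algebra_simps)

lemma aug_proj3_zero: "aug_proj3 0 = 0"
  by (auto simp: aug_proj3_def aug_proj_def dual_counit_def)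

lemma counit_linear:
  "counit1 0 = 0" "counit2 0 = 0" "counit3 0 = 0"
  "counit1 (F + G) = counit1 F + counit1 G" "counit2 (F + G) = counit2 F + counit2 G"
  "counit3 (F + G) = counit3 F + counit3 G"
  "counit1 (F - G) = counit1 F - counit1 G" "counit2 (F - G) = counit2 F - counit2 G"
  "counit3 (F - G) = counit3 F - counit3 G"
  by (auto simp: counit1_def counit2_def counit3_def dual_counit_def)

lemma counit_one3: "counit1 one3 = one2" "counit2 one3 = one2" "counit3 one3 = one2"
  by (simp_all add: one3_def one2_def counit_pure dual_counit_def uea_one_eq uea_counit_word_class
      fscale_def)

lemma tensor3_aug_ideal_iff:
  "F \<in> tensor3 aug_ideal \<longleftrightarrow> F \<in> tensor3 dual \<and> counit1 F = 0 \<and> counit2 F = 0 \<and> counit3 F = 0"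
proof
  assume "F \<in> tensor3 aug_ideal"
  then show "F \<in> tensor3 dual \<and> counit1 F = 0 \<and> counit2 F = 0 \<and> counit3 F = 0"
    using subspace_aug_ideal
  proof (induction rule: tensor3_induct)
    case zero
    show ?case
      by (simp only: tensor3_closed counit_linear simp_thms)
  next
    case (pure_add a b c G)
    have "fscale 0 f = (0 :: ('g, 'k) form2)" for f
      by (auto simp: fscale_def)
    moreover have "pure3 a b c \<in> tensor3 dual"
      using pure_add by (simp add: pure3_in_tensor3 aug_idealD)
    ultimately show ?case
      using pure_add
      by (simp only: tensor3_closed counit_linear counit_pure aug_ideal_def mem_Collect_eq add_0
          simp_thms)
  qed
next
  assume F: "F \<in> tensor3 dual \<and> counit1 F = 0 \<and> counit2 F = 0 \<and> counit3 F = 0"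
  then have "aug_proj3 F = F"
    by (auto simp: aug_proj3_def aug_proj_def dual_counit_def counit1_def counit2_def counit3_def
        fun_eq_iff)
  moreover have "aug_proj3 F \<in> tensor3 aug_ideal"
    using F[THEN conjunct1] subspace_dual
    by (induction rule: tensor3_induct)
      (simp_all only: aug_proj3_zero aug_proj3_add aug_proj3_pure tensor3_closed pure3_in_tensor3
        aug_proj_in_aug_ideal)
  ultimately show "F \<in> tensor3 aug_ideal"
    by simp
qed

lemma tensor3_aug_multilinear: "F \<in> tensor3 aug_ideal \<Longrightarrow> F \<in> multilinear3"
  using tensor3_dual_multilinear by (auto simp: tensor3_aug_ideal_iff)

lemma coef_to_shuf3_aug_Nil:
  assumes "F \<in> tensor3 aug_ideal"
  shows "coef (to_shuf3 F) [] = 0"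
proof -
  have "F (word_class [], y, z) = 0" for y z
    using assms
    by (simp add: tensor3_aug_ideal_iff counit1_def dual_counit_def uea_one_eq fun_eq_iff)
  then show ?thesis
    by (intro shuf_eqI) simp
qed

lemma mult3_tensor_aug:
  "F \<in> tensor3 aug_ideal \<Longrightarrow> G \<in> tensor3 aug_ideal \<Longrightarrow> mult3 F G \<in> tensor3 aug_ideal"
  by (rule tensor3_mult[OF subspace_aug_ideal aug_ideal_mult])

definition unipotent :: "('g, 'k) form3 \<Rightarrow> bool" where
  "unipotent G \<longleftrightarrow> G - one3 \<in> tensor3 aug_ideal"

lemma unipotent_one_add: "\<tau> \<in> tensor3 aug_ideal \<Longrightarrow> unipotent (one3 + \<tau>)"
  by (simp add: unipotent_def)

lemma unipotentE:
  assumes "unipotent G"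
  obtains \<tau> where "G = one3 + \<tau>" "\<tau> \<in> tensor3 aug_ideal"
  using assms that[of "G - one3"] by (simp add: unipotent_def)

lemma unipotent_multilinear: "unipotent G \<Longrightarrow> G \<in> multilinear3"
  by (elim unipotentE)
    (simp add: fun_space.subspace_add[OF subspace_multilinear3] one3_multilinear
      tensor3_aug_multilinear)

lemma unipotent_eqI: "unipotent F \<Longrightarrow> unipotent G \<Longrightarrow> to_shuf3 F = to_shuf3 G \<Longrightarrow> F = G"
  by (simp add: to_shuf3_eqD unipotent_multilinear)

lemma unipotent_mult:
  assumes "unipotent F" "unipotent G"
  shows "unipotent (mult3 F G)"
proof -
  obtain \<tau> \<sigma> where F: "F = one3 + \<tau>" and G: "G = one3 + \<sigma>"
    and aug: "\<tau> \<in> tensor3 aug_ideal" "\<sigma> \<in> tensor3 aug_ideal"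
    using assms by (elim unipotentE)
  have "mult3 F G = one3 + (\<sigma> + (\<tau> + mult3 \<tau> \<sigma>))"
    by (simp add: F G mult3_bilinear mult3_one_left mult3_one_right one3_multilinear
        tensor3_aug_multilinear aug add.assoc)
  then show ?thesis
    using aug by (simp only: unipotent_one_add tensor3_closed mult3_tensor_aug)
qed

lemma associator_unipotent:
  assumes "associator \<Phi>"
  shows "unipotent \<Phi>"
proof -
  have "\<Phi> \<in> tensor3 dual" "counit1 \<Phi> = one2" "counit2 \<Phi> = one2" "counit3 \<Phi> = one2"
    using assms by (simp_all add: associator_def)
  then show ?thesis
    using one3_tensor
    by (simp add: unipotent_def tensor3_aug_ideal_iff tensor3_closed counit_linear counit_one3)
qed


section \<open>The exponential homomorphism\<close>

lemma power3_multilinear: "T \<in> multilinear3 \<Longrightarrow> power3 T j \<in> multilinear3"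
  by (induction j) (simp_all add: power3_def one3_multilinear mult3_multilinear)

lemma to_shuf3_power: "T \<in> multilinear3 \<Longrightarrow> to_shuf3 (power3 T j) = to_shuf3 T ^ j"
proof (induction j)
  case (Suc j)
  then show ?case
    using power3_multilinear[of T j] by (simp add: power3_def to_shuf3_mult)
qed (simp add: power3_def to_shuf3_one)

lemma power3_tensor_aug:
  assumes "T \<in> tensor3 aug_ideal"
  shows "power3 T (Suc j) \<in> tensor3 aug_ideal"
proof (induction j)
  case 0
  show ?case
    using assms by (simp add: power3_def mult3_one_right tensor3_aug_multilinear)
next
  case (Suc j)
  then show ?case
    using mult3_tensor_aug[OF assms] by (simp add: power3_def)
qed

lemma truncated_exp_unipotent:
  assumes "T \<in> tensor3 aug_ideal"
  shows "unipotent (truncated_exp T)"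
proof -
  obtain q where "p = Suc q"
    using char_pos gr0_implies_Suc by blast
  then have "truncated_exp T = power3 T 0 +
      (\<Sum>j<q. fscale (inverse (of_nat (fact (Suc j)))) (power3 T (Suc j)))"
    unfolding truncated_exp_def by (simp only: sum.lessThan_Suc_shift) simp
  moreover have "power3 T 0 = one3"
    by (simp add: power3_def)
  ultimately show ?thesis
    using assms by (simp only: unipotent_one_add tensor3_closed power3_tensor_aug)
qed

lemma of_nat_Suc_mult_inverse_fact:
  assumes "Suc j < p"
  shows "of_nat (Suc j) * inverse (of_nat (fact (Suc j))) = (inverse (of_nat (fact j)) :: 'k)"
proof -
  have "of_nat (Suc j) \<noteq> (0::'k)"
    using assms char_eq nat_dvd_not_less[of "Suc j" p]
    by (metis of_nat_eq_0_iff_char_dvd zero_less_Suc)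
  then show ?thesis
    by (simp only: fact_Suc of_nat_mult of_nat_id inverse_mult_distrib) simp
qed

text \<open>The derivative affects the first tensor factor only, so that \<open>T\<^bsup>p-1\<^esup> \<partial>T\<close> has the third tensor
  factor \<open>c\<^sup>p = 0\<close>.\<close>

lemma to_shuf3_pure_power_mult_deriv:
  assumes "c \<in> aug_ideal"
  shows "to_shuf3 (pure3 a b c) ^ (p - 1) * shuf_deriv x (to_shuf3 (pure3 a b c)) = 0"
  unfolding to_shuf3_pure
proof (rule power_mult_shuf_deriv_eq_0)
  have "to_shuf c ^ p = 0"
    using shuf_power_CHAR_eq_0[of "to_shuf c"] char_eq char_pos aug_idealD(2)[OF assms] by simp
  then show "(shuf_map shuf_const (to_shuf b) * shuf_const (to_shuf c)) ^ Suc (p - 1) = 0"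
    using char_pos by (simp add: power_mult_distrib shuf_const_simps flip: shuf_const_power)
qed

lemma to_shuf3_truncated_exp:
  assumes abc: "a \<in> aug_ideal" "b \<in> aug_ideal" "c \<in> aug_ideal"
  shows "to_shuf3 (truncated_exp (pure3 a b c)) = shuf_exp (to_shuf3 (pure3 a b c))"
proof -
  let ?T = "pure3 a b c"
  let ?k = "\<lambda>j. shuf_const (shuf_const (inverse (of_nat (fact j)))) :: ('g, ('g, 'k) shuf) shuf"
  have T: "?T \<in> tensor3 aug_ideal"
    using abc by (rule pure3_in_tensor3)
  have k: "of_nat (Suc j) * ?k (Suc j) = ?k j" if "j < p - 1" for j
    using of_nat_Suc_mult_inverse_fact[of j] that
    by (simp only: of_nat_shuf less_diff_conv add_Suc_right add_0_right One_nat_def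
        flip: shuf_const_simps)
  have "to_shuf3 (truncated_exp ?T) = (\<Sum>j<p. shuf_const (?k j) * to_shuf3 ?T ^ j)"
    by (simp add: truncated_exp_def to_shuf3_sum to_shuf3_simps to_shuf3_power
        tensor3_aug_multilinear T)
  also have "{..<p} = {..p - 1}"
    using char_pos by auto
  also have "(\<Sum>j\<in>\<dots>. shuf_const (?k j) * to_shuf3 ?T ^ j) = shuf_exp (to_shuf3 ?T)"
  proof (rule truncated_exp_eq_shuf_exp)
    show "?k 0 = 1"
      by (simp add: shuf_const_simps)
  qed (simp_all only: k coef_to_shuf3_aug_Nil[OF T] to_shuf3_pure_power_mult_deriv abc)
  finally show ?thesis .
qed

lemma ex_unipotent_exp:
  assumes "\<phi> \<in> tensor3 aug_ideal"
  shows "\<exists>G. unipotent G \<and> to_shuf3 G = shuf_exp (to_shuf3 \<phi>)"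
  using assms subspace_aug_ideal
proof (induction rule: tensor3_induct)
  case zero
  have "unipotent one3"
    using unipotent_one_add[OF tensor3_closed(1)] by simp
  moreover have "to_shuf3 one3 = shuf_exp (to_shuf3 0)"
    by (simp only: to_shuf3_one to_shuf3_simps shuf_exp_zero)
  ultimately show ?case
    by blast
next
  case (pure_add a b c F)
  then obtain G where G: "unipotent G" "to_shuf3 G = shuf_exp (to_shuf3 F)"
    by blast
  have T: "unipotent (truncated_exp (pure3 a b c))"
    using pure_add by (intro truncated_exp_unipotent pure3_in_tensor3)
  show ?case
  proof (intro exI conjI)
    show "unipotent (mult3 (truncated_exp (pure3 a b c)) G)"
      using T G(1) by (rule unipotent_mult)
    show "to_shuf3 (mult3 (truncated_exp (pure3 a b c)) G) = shuf_exp (to_shuf3 (pure3 a b c + F))"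
      using pure_add.hyps T G
      by (simp add: to_shuf3_mult unipotent_multilinear to_shuf3_truncated_exp to_shuf3_simps
          shuf_exp_add)
  qed
qed

definition exp_form :: "('g, 'k) form3 \<Rightarrow> ('g, 'k) form3" where
  "exp_form \<phi> = (if \<phi> \<in> tensor3 aug_ideal
     then SOME G. unipotent G \<and> to_shuf3 G = shuf_exp (to_shuf3 \<phi>) else undefined)"

lemma exp_form:
  assumes "\<phi> \<in> tensor3 aug_ideal"
  shows exp_form_unipotent: "unipotent (exp_form \<phi>)"
    and to_shuf3_exp_form: "to_shuf3 (exp_form \<phi>) = shuf_exp (to_shuf3 \<phi>)"
  using someI_ex[OF ex_unipotent_exp[OF assms]] assms by (simp_all add: exp_form_def)

lemma exp_form_add:
  assumes "\<phi> \<in> tensor3 aug_ideal" "\<psi> \<in> tensor3 aug_ideal"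
  shows "exp_form (\<phi> + \<psi>) = mult3 (exp_form \<phi>) (exp_form \<psi>)"
  using assms
  by (intro unipotent_eqI)
    (simp_all add: exp_form tensor3_closed unipotent_mult to_shuf3_mult unipotent_multilinear
      to_shuf3_simps shuf_exp_add)

lemma exp_form_pure:
  assumes "a \<in> aug_ideal" "b \<in> aug_ideal" "c \<in> aug_ideal"
  shows "exp_form (pure3 a b c) = truncated_exp (pure3 a b c)"
  using assms
  by (intro unipotent_eqI)
    (simp_all add: exp_form pure3_in_tensor3 truncated_exp_unipotent to_shuf3_truncated_exp)

lemma dual_family_regular:
  assumes "\<And>f. f \<in> V \<Longrightarrow> F f \<in> dual"
    and words: "\<And>w. (\<lambda>f. F f (word_class w)) \<in> regular_functions_on V"
  shows "(\<lambda>f. F f X) \<in> regular_functions_on V"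
proof (cases "X \<in> uea")
  case True
  then obtain t where X: "X = coset t"
    by (auto simp: uea_def)
  have "(\<lambda>f. lin_ext (\<lambda>w. F f (word_class (letters w))) t) \<in> regular_functions_on V"
    by (intro function_subalgebra_lin_ext function_subalgebra_regular words)
  then show ?thesis
    by (rule regular_functions_on_cong) (simp add: X dual_coset assms(1))
next
  case False
  show ?thesis
    using function_subalgebraD(1)[OF function_subalgebra_regular, of 0]
    by (rule regular_functions_on_cong) (use False assms(1) dual_outside in blast)
qed

lemma multilinear3_family_regular:
  fixes F :: "('x \<Rightarrow> 'k) \<Rightarrow> ('g, 'k) form3"
  assumes F: "\<And>f. f \<in> V \<Longrightarrow> F f \<in> multilinear3"
    and words: "\<And>u v w.
      (\<lambda>f. F f (word_class u, word_class v, word_class w)) \<in> regular_functions_on V"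
  shows "regular_map_on V F"
proof -
  have third: "(\<lambda>f. F f (word_class u, word_class v, z)) \<in> regular_functions_on V" for u v z
    by (rule dual_family_regular[where F = "\<lambda>f z. F f (word_class u, word_class v, z)"])
      (simp_all add: multilinear3D F words)
  have second: "(\<lambda>f. F f (word_class u, y, z)) \<in> regular_functions_on V" for u y z
    by (rule dual_family_regular[where F = "\<lambda>f y. F f (word_class u, y, z)"])
      (simp_all add: multilinear3D F third)
  have "(\<lambda>f. F f (x, y, z)) \<in> regular_functions_on V" for x y z
    by (rule dual_family_regular[where F = "\<lambda>f x. F f (x, y, z)"])
      (simp_all add: multilinear3D F second)
  then show ?thesis
    by (simp add: regular_map_on_iff)
qed

lemma exp_form_regular: "regular_map_on (tensor3 aug_ideal) exp_form"
proof (rule multilinear3_family_regular)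
  fix u v w
  let ?R = "regular_functions_on (tensor3 aug_ideal)"
  have "(\<lambda>\<phi>. shuf_exp (to_shuf3 \<phi>)) \<in> coefficientwise (coefficientwise (coefficientwise ?R))"
    by (intro coefficientwise_shuf_exp function_subalgebra_coefficientwise
        function_subalgebra_regular)
      (simp add: coefficientwise_def coord_regular)
  then have "(\<lambda>\<phi>. coef (coef (coef (shuf_exp (to_shuf3 \<phi>)) u) v) w) \<in> ?R"
    by (simp add: coefficientwise_def)
  then show "(\<lambda>\<phi>. exp_form \<phi> (word_class u, word_class v, word_class w)) \<in> ?R"
    by (rule regular_functions_on_cong) (simp flip: to_shuf3_exp_form)
qed (simp add: unipotent_multilinear exp_form_unipotent)

lemma exp_form_unipotent_hom: "unipotent_hom exp_form"
  unfolding unipotent_hom_def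
proof (intro conjI ballI)
  show "exp_form \<in> extensional (tensor3 aug_ideal)"
    by (simp add: extensional_def exp_form_def)
  show "exp_form ` tensor3 aug_ideal \<subseteq> {one3 + \<tau> |\<tau>. \<tau> \<in> tensor3 aug_ideal}"
    using exp_form_unipotent by (auto elim!: unipotentE)
qed (simp_all add: exp_form_regular exp_form_add)

lemma unipotent_hom_eq_exp_form:
  assumes E: "unipotent_hom E"
    and pure: "\<And>a b c. a \<in> aug_ideal \<Longrightarrow> b \<in> aug_ideal \<Longrightarrow> c \<in> aug_ideal \<Longrightarrow>
      E (pure3 a b c) = truncated_exp (pure3 a b c)"
  shows "E = exp_form"
proof (rule extensionalityI[of _ "tensor3 aug_ideal"])
  show "E \<in> extensional (tensor3 aug_ideal)" "exp_form \<in> extensional (tensor3 aug_ideal)"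
    using E exp_form_unipotent_hom by (simp_all add: unipotent_hom_def)
  fix \<phi> assume "\<phi> \<in> tensor3 aug_ideal"
  then show "E \<phi> = exp_form \<phi>"
    using subspace_aug_ideal
  proof (induction rule: tensor3_induct)
    case zero
    have "0 \<in> aug_ideal"
      using subspace_aug_ideal by (rule fun_space.subspace_0)
    then have "E (pure3 0 0 0) = exp_form (pure3 0 0 0)"
      by (simp only: pure exp_form_pure)
    then show ?case
      by (simp only: pure3_zero)
  next
    case (pure_add a b c F)
    then have "pure3 a b c \<in> tensor3 aug_ideal"
      by (intro pure3_in_tensor3)
    then have "E (pure3 a b c + F) = mult3 (E (pure3 a b c)) (E F)"
      using E pure_add by (simp add: unipotent_hom_def)
    then show ?case
      using pure_add \<open>pure3 a b c \<in> tensor3 aug_ideal\<close>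
      by (simp only: pure exp_form_pure exp_form_add)
  qed
qed

lemma exp_hom_eq: "exp_hom = exp_form"
  unfolding exp_hom_def
  by (rule the_equality)
    (auto simp: exp_form_unipotent_hom exp_form_pure intro: unipotent_hom_eq_exp_form)

lemma inj_on_exp_form: "inj_on exp_form (tensor3 aug_ideal)"
proof (rule inj_onI)
  fix \<phi> \<psi> assume aug: "\<phi> \<in> tensor3 aug_ideal" "\<psi> \<in> tensor3 aug_ideal" and "exp_form \<phi> = exp_form \<psi>"
  then have "shuf_exp (to_shuf3 \<phi>) = shuf_exp (to_shuf3 \<psi>)"
    by (simp flip: to_shuf3_exp_form)
  then have "shuf_deriv x (to_shuf3 \<phi>) = shuf_deriv x (to_shuf3 \<psi>)" for x
    by (simp add: shuf_exp_eq_iff)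
  then have "to_shuf3 \<phi> = to_shuf3 \<psi>"
    by (rule shuf_eq_derivI[rotated]) (simp add: coef_to_shuf3_aug_Nil aug)
  with aug show "\<phi> = \<psi>"
    by (simp add: to_shuf3_eqD tensor3_aug_multilinear)
qed


section \<open>Surjectivity of the exponential\<close>

text \<open>The spanning half of the Poincare-Birkhoff-Witt theorem, in dual form: modulo shorter words
  the letters of a word commute and \<open>p\<close> equal letters can be merged, so that words over a basis
  need to have at most \<open>p - 1\<close> occurrences of each letter.\<close>

lemma respects_relators_permute:
  assumes g: "respects_relators g" and short: "\<And>v. length v < length w \<Longrightarrow> g v = 0"
    and "mset v = mset w"
  shows "g v = g w"
proof (rule eq_of_mset_eq_if_swap)
  fix u v :: "'g list" and x y :: 'g assume "length (u @ x # y # v) = length w"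
  then have "g (u @ br x y # v) = 0"
    by (intro short) simp
  then show "g (u @ x # y # v) = g (u @ y # x # v)"
    using g by (simp add: respects_relators_iff)
qed (simp_all add: assms)

lemma respects_relators_repeated_letter:
  assumes g: "respects_relators g" and short: "\<And>v. length v < length w \<Longrightarrow> g v = 0"
    and "p \<le> count_list w b"
  shows "g w = 0"
proof -
  have "replicate_mset p b \<subseteq># mset w"
    using assms(3) by (simp add: count_mset flip: count_le_replicate_mset_subset_eq)
  then obtain v where v: "mset (replicate p b @ v) = mset w"
    by (metis ex_mset mset_append mset_replicate subset_mset.add_diff_inverse)
  then have "length w = p + length v"
    by (metis length_append length_replicate size_mset)
  then have "g (pmap b # v) = 0"
    using prime_gt_1_nat[OF prime_char] by (intro short) simp
  moreover have "g ([] @ pmap b # v) = g ([] @ replicate p b @ v)"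
    using g unfolding respects_relators_iff by blast
  ultimately show ?thesis
    using respects_relators_permute[OF g short v] by simp
qed

lemma respects_relators_eq_0_if_eq_0_on_span:
  assumes g: "respects_relators g" and B: "span B = UNIV"
    and basis: "\<And>w. set w \<subseteq> B \<Longrightarrow> length w = n \<Longrightarrow> g w = 0"
    and "length w = n"
  shows "g w = 0"
proof -
  have "g (u @ v) = 0" if "set u \<subseteq> B" "length (u @ v) = n" for u v
    using that
  proof (induction v arbitrary: u)
    case (Cons x v)
    have "x \<in> span B"
      by (simp add: B)
    then show ?case
    proof (induction rule: span_induct_alt)
      case base
      have "g (u @ scale 0 0 # v) = 0 * g (u @ 0 # v)"
        using g by (simp only: respects_relators_iff)
      then show ?case
        by simp
    next
      case (step c y z)
      then show ?case
        using g Cons.IH[of "u @ [y]"] Cons.prems by (simp add: respects_relators_iff)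
    qed
  qed (simp add: basis)
  from this[of "[]" w] show ?thesis
    using \<open>length w = n\<close> by simp
qed

lemma respects_relators_eq_0_if_eq_0_on_short_words:
  assumes B: "finite B" "span B = UNIV" and g: "respects_relators g"
    and short: "\<And>w. length w \<le> card B * (p - 1) \<Longrightarrow> g w = 0"
  shows "g w = 0"
proof (induction "length w" arbitrary: w rule: less_induct)
  case less
  have "g v = 0" if v: "set v \<subseteq> B" "length v = length w" for v
  proof (cases "length v \<le> card B * (p - 1)")
    case False
    then obtain b where "p - 1 < count_list v b"
      using pigeonhole_count_list[OF B(1) v(1), of "p - 1"] by auto
    then have "p \<le> count_list v b"
      by simp
    moreover have "g u = 0" if "length u < length v" for u
      using less that v(2) by simp
    ultimately show ?thesis
      using respects_relators_repeated_letter[OF g] by blast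
  qed (rule short)
  then show ?case
    by (rule respects_relators_eq_0_if_eq_0_on_span[OF g B(2) _ refl])
qed

lemma multilinear3_eq_0_if_vanishes_below:
  assumes B: "finite B" "span B = UNIV" and F: "F \<in> multilinear3"
    and vanish: "vanishes_below (Suc (card B * (p - 1))) (to_shuf3 F)"
  shows "F = 0"
proof (rule to_shuf3_eqD)
  have "F (word_class u, word_class v, word_class w) = 0" for u v w
  proof (rule respects_relators_eq_0_if_eq_0_on_short_words[OF B
        dual_respects_relators[OF multilinear3D(1)[OF F]]])
    show "F (word_class u, word_class v, word_class w) = 0" if "length u \<le> card B * (p - 1)" for u
    proof -
      have "coef (to_shuf3 F) u = 0"
        using vanish that by (simp add: vanishes_below_def)
      then have "coef (coef (coef (to_shuf3 F) u) v) w = 0"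
        by simp
      then show ?thesis
        by simp
    qed
  qed
  then show "to_shuf3 F = to_shuf3 0"
    by (intro shuf_eqI) simp
qed (simp_all add: F fun_space.subspace_0[OF subspace_multilinear3])

lemma ex_exp_form_approximation:
  assumes \<Phi>: "unipotent \<Phi>"
  shows "\<exists>\<phi>\<in>tensor3 aug_ideal. vanishes_below (Suc n) (to_shuf3 \<Phi> - shuf_exp (to_shuf3 \<phi>))"
proof (induction n)
  case 0
  obtain \<tau> where "\<Phi> = one3 + \<tau>" and \<tau>: "\<tau> \<in> tensor3 aug_ideal"
    using \<Phi> by (rule unipotentE)
  then have "to_shuf3 \<Phi> - shuf_exp (to_shuf3 0) = to_shuf3 \<tau>"
    by (simp only: to_shuf3_simps to_shuf3_one shuf_exp_zero add_diff_cancel_left')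
  then have "vanishes_below (Suc 0) (to_shuf3 \<Phi> - shuf_exp (to_shuf3 0))"
    by (simp add: vanishes_below_def coef_to_shuf3_aug_Nil \<tau>)
  then show ?case
    using tensor3_closed(1) by blast
next
  case (Suc n)
  then obtain \<phi> where \<phi>: "\<phi> \<in> tensor3 aug_ideal"
    and approx: "vanishes_below (Suc n) (to_shuf3 \<Phi> - shuf_exp (to_shuf3 \<phi>))"
    by blast
  let ?\<Psi> = "mult3 (exp_form (- \<phi>)) \<Phi>"
  have neg: "- \<phi> \<in> tensor3 aug_ideal"
    using \<phi> by (rule tensor3_closed)
  obtain \<tau> where \<Psi>: "?\<Psi> = one3 + \<tau>" and \<tau>: "\<tau> \<in> tensor3 aug_ideal"
    using unipotent_mult[OF exp_form_unipotent[OF neg] \<Phi>] by (rule unipotentE)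
  have "1 + to_shuf3 \<tau> = to_shuf3 ?\<Psi>"
    by (simp only: \<Psi> to_shuf3_simps to_shuf3_one)
  also have "\<dots> = shuf_exp (- to_shuf3 \<phi>) * to_shuf3 \<Phi>"
    by (simp add: to_shuf3_mult exp_form neg \<Phi> unipotent_multilinear to_shuf3_simps)
  finally have "vanishes_below (Suc (Suc n)) (to_shuf3 \<Phi> - shuf_exp (to_shuf3 \<phi> + to_shuf3 \<tau>))"
    using approx by (intro shuf_exp_correction)
  then show ?case
    using tensor3_closed(2)[OF \<phi> \<tau>] by (metis to_shuf3_simps(2))
qed

lemma ex_exp_form_eq:
  assumes B: "finite B" "span B = UNIV" and \<Phi>: "unipotent \<Phi>"
  shows "\<exists>\<phi>\<in>tensor3 aug_ideal. \<Phi> = exp_form \<phi>"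
proof -
  obtain \<phi> where \<phi>: "\<phi> \<in> tensor3 aug_ideal"
    and "vanishes_below (Suc (card B * (p - 1))) (to_shuf3 \<Phi> - shuf_exp (to_shuf3 \<phi>))"
    using ex_exp_form_approximation[OF \<Phi>] by blast
  then have "vanishes_below (Suc (card B * (p - 1))) (to_shuf3 (\<Phi> - exp_form \<phi>))"
    by (simp add: to_shuf3_simps to_shuf3_exp_form)
  moreover have "\<Phi> - exp_form \<phi> \<in> multilinear3"
    using \<Phi> \<phi>
    by (intro fun_space.subspace_diff subspace_multilinear3 unipotent_multilinear
        exp_form_unipotent)
  ultimately have "\<Phi> - exp_form \<phi> = 0"
    using multilinear3_eq_0_if_vanishes_below[OF B] by blast
  with \<phi> show ?thesis
    by auto
qed


section \<open>Associators and cocycles\<close>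

lemma associator_exp_form_imp_cocycle:
  assumes \<phi>: "\<phi> \<in> tensor3 aug_ideal" and assoc: "associator (exp_form \<phi>)"
  shows "\<phi> \<in> cocycles3"
proof -
  let ?\<Phi> = "exp_form \<phi>"
  note maps = ring_map_shuf_map[OF ring_map_deconc] ring_map_deconc
    ring_map_shuf_map[OF ring_map_shuf_map[OF ring_map_shuf_const]]
  have multilinear: "?\<Phi> \<in> multilinear3" "\<phi> \<in> multilinear3"
    using \<phi> by (simp_all add: exp_form unipotent_multilinear tensor3_aug_multilinear)
  have "to_shuf4 (mult4 (comult3 ?\<Phi>) (comult1 ?\<Phi>)) =
      to_shuf4 (mult4 (mult4 (tensor_one_left ?\<Phi>) (comult2 ?\<Phi>)) (tensor_one_right ?\<Phi>))"
    using assoc by (simp add: associator_def)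
  then have "to_shuf4 (comult3 \<phi> + comult1 \<phi>) =
      to_shuf4 (tensor_one_left \<phi> + comult2 \<phi> + tensor_one_right \<phi>)"
    by (simp add: to_shuf4_mult mult4_multilinear comult_multilinear multilinear to_shuf4_comult
        to_shuf4_add exp_form \<phi> shuf_exp_pentagon_iff[OF maps coef_to_shuf3_aug_Nil[OF \<phi>]])
  then have "comult3 \<phi> + comult1 \<phi> = tensor_one_left \<phi> + comult2 \<phi> + tensor_one_right \<phi>"
    by (rule to_shuf4_eqD)
      (intro fun_space.subspace_add subspace_multilinear4 comult_multilinear multilinear)+
  then show ?thesis
    using \<phi> by (simp add: cocycles3_def)
qed

theorem associator_eq_exp_hom:
  assumes "finite B" "span B = UNIV" and \<Phi>: "associator \<Phi>"
  shows "\<exists>!\<phi>. \<phi> \<in> cocycles3 \<and> \<Phi> = exp_hom \<phi>"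
proof -
  obtain \<phi> where "\<phi> \<in> tensor3 aug_ideal" "\<Phi> = exp_form \<phi>"
    using ex_exp_form_eq[OF assms(1,2) associator_unipotent[OF \<Phi>]] by blast
  moreover from this have "\<phi> \<in> cocycles3"
    using associator_exp_form_imp_cocycle \<Phi> by blast
  ultimately show ?thesis
    unfolding exp_hom_eq
    by (intro ex1I[of _ \<phi>]) (auto simp: cocycles3_def intro: inj_onD[OF inj_on_exp_form])
qed

end

theorem corollary5p14:
  fixes p :: nat
    and scale :: "'k::alg_closed_field \<Rightarrow> 'g::ab_group_add \<Rightarrow> 'g"
    and br :: "'g \<Rightarrow> 'g \<Rightarrow> 'g"
    and pmap :: "'g \<Rightarrow> 'g"
    and \<Phi> :: "('g, 'k) form3"
  assumes "p > 0" and "CHAR('k) = p"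
    and "restricted_lie_algebra scale p br pmap"
    and "\<exists>B. finite B \<and> module.span scale B = UNIV"
    and "restricted_lie_algebra.associator scale p br pmap \<Phi>"
  shows "\<exists>!\<phi>. \<phi> \<in> restricted_lie_algebra.cocycles3 scale p br pmap \<and>
              \<Phi> = restricted_lie_algebra.exp_hom scale p br pmap \<phi>"
proof -
  interpret restricted_lie_algebra scale p br pmap
    by fact
  obtain B where "finite B" "span B = UNIV"
    using assms(4) by blast
  then show ?thesis
    using assms(5) by (rule associator_eq_exp_hom)
qed

end
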